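(* Let $E$ be a (real) Banach space. (1) For every countable ordinal $\alpha$ and every $m\in\mathbb{N}$, the following assertions are equivalent: (i) $\mathcal{C}([1,\omega^\alpha m])$ is isometric to a complemented subspace of $E$; (ii) $E$ admits an isometric projectional tree of rank $\alpha+1$ and order $m$. (2) The following assertions are equivalent: (i) $\mathcal{C}(2^\omega)$ is isometric to a complemented subspace of $E$; (ii) $E$ admits an isometric projectional tree of rank $\infty$ and order $1$.
   Context: Conventions: $\omega=\{0,1,2,\dots\}$, $\mathbb{N}=\{1,2,\dots\}$; Banach spaces are real, operators are linear; $\mathcal{C}(L)$ is the space of continuous real functions on a compact Hausdorff space $L$ with the sup norm; ordinal intervals carry the order topology; $2^\omega$ is the Cantor space. A closed subspace is complemented if it is the range of a bounded linear projection. An isometric (isomorphic) embedding is a linear isometry (isomorphism) onto its range. Trees. $\mathbb{L}=\omega^{<\omega}$ is the set of finite sequences in $\omega$, $\epsilon$ the empty sequence, $l(s)$ the length of $s$, $s\preceq t$ means $s$ is an initial segment of $t$, $s\prec t$ means $s\preceq t$ and $s\ne t$, $s*n$ is $s$ with $n$ appended. $\Lambda\subseteq\mathbb{L}$ is hereditary if $s\preceq t\in\Lambda$ implies $s\in\Lambda$. A leaf of $\Lambda$ is an $s\in\Lambda$ with no $t\in\Lambda$, $s\prec t$; $NL(\Lambda)$ is the set of non-leaves. If $\Lambda$ is hereditary, $\epsilon\in\Lambda$, and $\Lambda$ has no infinite branch (no infinite $\prec$-increasing sequence), set $r(s)=0$ for leaves and $r(s)=\sup\{r(t)+1: t\in\Lambda,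 s\prec t\}$ otherwise. For a countable ordinal $\alpha$, a tree of rank $\alpha+1$ is a hereditary $\Lambda\subseteq\mathbb{L}$ with $\epsilon\in\Lambda$, without infinite branches, with $r(\epsilon)=\alpha$, such that each $s\in\Lambda$ is a leaf or satisfies $s*n\in\Lambda$ for all $n\in\omega$, and for each $s\in NL(\Lambda)$ the sequence $(r(s*n))_{n\in\omega}$ is constant or strictly increasing. The tree of rank $\infty$ is $\mathbb{L}$ itself. Spaces $\mathcal{A}_\Lambda$. For a tree $\Lambda$ and $a=(a_s)_{s\in\Lambda}\in\mathbb{R}^\Lambda$ let $\|a\|^\Lambda=\sup_{t\in\Lambda}|\sum_{s\preceq t}a_s|$. For $\Omega\subseteq\Lambda$, $a\restriction\Omega\in\mathbb{R}^\Lambda$ equals $a$ on $\Omega$ and $0$ off $\Omega$. Let $\Lambda_s=\{t\in\Lambda:s\preceq t\}$. $\mathcal{A}_\Lambda$ is the normed space (norm $\|\cdot\|^\Lambda$) of all $a\in\mathbb{R}^\Lambda$ with (A.1) $\|a\|^\Lambda<\infty$; (A.2) $\lim_{n}\|a\restriction\Lambda_{s*n}\|^\Lambda=0$ for each $s\in NL(\Lambda)$; (A.3) $\lim_n\|a\restriction\{t\in\Lambda:l(t)\ge n\}\|^\Lambda=0$. $\mathcal{A}_\Lambda^m$ is its $m$-th power with the maximum norm. $\Sigma_m(\Lambda)=\Lambda\times\{1,\dots,m\}$. For $(s,i)\in\Sigma_m(\Lambda)$, $\tilde\delta_{s,i}\in(\mathcal{A}_\Lambda^m)^*$ is $\tilde\delta_{s,i}\big((a_{t,j})_{(t,j)}\big)=\sum_{t\preceq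 s}a_{t,i}$. Metric on trees. For $s=\langle s_1,\dots,s_n\rangle\in\mathbb{L}$ let $R(s)\in 2^\omega$ be the sequence consisting of $s_1$ ones, a zero, $s_2$ ones, a zero, …, $s_n$ ones, a zero, followed by infinitely many ones ($R(\epsilon)$ is constantly $1$). $R$ is injective; trees are metrized by $d(s,t)=d_{2^\omega}(R(s),R(t))$, where $d_{2^\omega}(x,y)=2^{-k}$ with $k$ the first index at which $x\ne y$ differ, and $d_{2^\omega}(x,x)=0$. $\Sigma_m(\Lambda)$ is the disjoint union of $m$ copies of this metric space (points in different copies at distance $1$). A map $\rho:X\to E^*$ on a metric space $(X,d)$ is uniformly weak$^*$ continuous if for all $e\in E$ and sequences $(x_n),(y_n)$ in $X$, $d(x_n,y_n)\to0$ implies $\langle\rho(x_n)-\rho(y_n),e\rangle\to0$. Projectional tree. Let $\beta$ be a countable successor ordinal or $\infty$ and $m\in\mathbb{N}$. A projectional tree of rank $\beta$ and order $m$ in $E$ is a triple $(\Sigma,T,\rho)$ where $\Sigma=\Sigma_m(\Lambda)$ for some tree $\Lambda$ of rank $\beta$, $T:\mathcal{A}_\Lambda^m\to E$ is an isomorphic embedding, and $\rho:\Sigma\to E^*$ is uniformly weak$^*$ continuous with bounded range and satisfies $T^*(\rho(s,i))=\tilde\delta_{s,i}$ for all $(s,i)\in\Sigma$. It is isometric if $T$ is an isometry. *)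

theory Defs
  imports "HOL-Analysis.Analysis" "HOL-Library.Sublist"
begin

section \<open>Countable ordinals\<close>

text \<open>Countable ordinals are the isomorphism classes of well-orders on subsets of \<^typ>\<open>nat\<close>.
  The domain of a well-order is its field, so the empty relation represents \<open>0\<close>.\<close>

quotient_type cord = "nat rel" / partial: "\<lambda>r s. (r, s) \<in> ordIso"
proof (rule part_equivpI)
  have "Well_order ({} :: nat rel)"
    by simp
  then show "\<exists>r::nat rel. (r, r) \<in> ordIso"
    using ordIso_reflexive by blast
  show "symp (\<lambda>r s :: nat rel. (r, s) \<in> ordIso)"
    by (rule sympI) (rule ordIso_symmetric)
  show "transp (\<lambda>r s :: nat rel. (r, s) \<in> ordIso)"
    by (rule transpI) (rule ordIso_transitive)
qed

lemma cord_cases: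
  obtains r where "Well_order r" "x = abs_cord r"
proof (induction x rule: cord.abs_induct)
  case (1 r)
  then have "Well_order r"
    by (simp add: ordIso_def)
  with 1 show thesis
    by blast
qed

instantiation cord :: wellorder
begin

lift_definition less_eq_cord :: "cord \<Rightarrow> cord \<Rightarrow> bool" is "\<lambda>r s. (r, s) \<in> ordLeq"
  by (meson ordIso_ordLeq_trans ordIso_symmetric ordLeq_ordIso_trans)

definition less_cord :: "cord \<Rightarrow> cord \<Rightarrow> bool"
  where "less_cord x y \<longleftrightarrow> x \<le> y \<and> \<not> y \<le> x"

lemma abs_cord_le:
  assumes "Well_order r" "Well_order s"
  shows "abs_cord r \<le> abs_cord s \<longleftrightarrow> (r, s) \<in> ordLeq"
  using assms by (simp add: less_eq_cord.abs_eq ordIso_reflexive)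

lemma abs_cord_less:
  assumes "Well_order r" "Well_order s"
  shows "abs_cord r < abs_cord s \<longleftrightarrow> (r, s) \<in> ordLess"
  using assms
  by (auto simp: less_cord_def abs_cord_le not_ordLeq_iff_ordLess ordLess_imp_ordLeq)

lemma abs_cord_eq:
  assumes "(r, s) \<in> ordIso"
  shows "abs_cord r = abs_cord s"
  using assms by (rule Quotient3_rel_abs[OF Quotient3_cord])

instance
proof
  fix x y z :: cord
  show "x < y \<longleftrightarrow> x \<le> y \<and> \<not> y \<le> x"
    by (rule less_cord_def)
  show "x \<le> x"
    by (cases x rule: cord_cases) (simp add: abs_cord_le ordLeq_reflexive)
  show "x \<le> z" if "x \<le> y" "y \<le> z"
    using that
    by (cases x rule: cord_cases; cases y rule: cord_cases; cases z rule: cord_cases)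
      (auto simp: abs_cord_le intro: ordLeq_transitive)
  show "x = y" if "x \<le> y" "y \<le> x"
    using that
    by (cases x rule: cord_cases; cases y rule: cord_cases)
      (auto simp: abs_cord_le ordIso_iff_ordLeq intro!: abs_cord_eq)
  show "x \<le> y \<or> y \<le> x"
    by (cases x rule: cord_cases; cases y rule: cord_cases)
      (auto simp: abs_cord_le ordLeq_total)
next
  fix P :: "cord \<Rightarrow> bool" and a :: cord
  assume step: "\<And>x. (\<And>y. y < x \<Longrightarrow> P y) \<Longrightarrow> P x"
  have "Well_order r \<longrightarrow> P (abs_cord r)" for r
  proof (induction r rule: wf_induct_rule[OF wf_ordLess])
    case (1 r)
    have "P y" if "Well_order r" "y < abs_cord r" for y
      using that 1 by (cases y rule: cord_cases) (auto simp: abs_cord_less)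
    then show ?case
      using step by blast
  qed
  then show "P a"
    by (cases a rule: cord_cases) auto
qed

end

instantiation cord :: linorder_topology
begin

definition open_cord :: "cord set \<Rightarrow> bool"
  where "open_cord = generate_topology (range (\<lambda>a. {..<a}) \<union> range (\<lambda>a. {a<..}))"

instance
  by standard (rule open_cord_def)

end

text \<open>Every countable set of countable ordinals is bounded (see \<open>countable_bdd_above\<close>), so \<open>Sup\<close> is
  its supremum; in particular \<open>Sup {} = 0\<close>.\<close>

instantiation cord :: conditionally_complete_linorder
begin

definition Inf_cord :: "cord set \<Rightarrow> cord"
  where "Inf_cord S = (LEAST x. x \<in> S)"

definition Sup_cord :: "cord set \<Rightarrow> cord"
  where "Sup_cord S = (LEAST y. \<forall>x\<in>S. x \<le> y)"

definition inf_cord :: "cord \<Rightarrow> cord \<Rightarrow> cord"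
  where "inf_cord = min"

definition sup_cord :: "cord \<Rightarrow> cord \<Rightarrow> cord"
  where "sup_cord = max"

instance
proof
  fix x :: cord and X :: "cord set"
  show "Inf X \<le> x" if "x \<in> X"
    using that unfolding Inf_cord_def by (rule Least_le)
  show "x \<le> Inf X" if "X \<noteq> {}" "\<And>y. y \<in> X \<Longrightarrow> x \<le> y"
    using that unfolding Inf_cord_def by (metis LeastI_ex ex_in_conv)
  show "x \<le> Sup X" if "x \<in> X" "bdd_above X"
  proof -
    have "\<forall>x\<in>X. x \<le> Sup X"
      using that(2) unfolding Sup_cord_def bdd_above_def by (rule LeastI_ex)
    then show ?thesis
      using that(1) by blast
  qed
  show "Sup X \<le> x" if "X \<noteq> {}" "\<And>y. y \<in> X \<Longrightarrow> y \<le> x"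
    using that unfolding Sup_cord_def by (simp add: Least_le)
qed (auto simp: inf_cord_def sup_cord_def)

end

lemma countable_lessThan_cord: "countable {..<x::cord}"
proof (cases x rule: cord_cases)
  case (1 r)
  have "{..<x} \<subseteq> range (\<lambda>a. abs_cord (Restr r (underS r a)))"
  proof
    fix y assume "y \<in> {..<x}"
    obtain s where s: "Well_order s" "y = abs_cord s"
      by (rule cord_cases)
    with 1 \<open>y \<in> {..<x}\<close> have "(s, r) \<in> ordLess"
      by (simp add: abs_cord_less)
    then obtain a where "(s, Restr r (underS r a)) \<in> ordIso"
      using ordLess_iff_ordIso_Restr 1 s by blast
    with s show "y \<in> range (\<lambda>a. abs_cord (Restr r (underS r a)))"
      by (auto intro: abs_cord_eq)
  qed
  then show ?thesis
    by (rule countable_subset) simp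
qed

lemma countable_atMost_cord: "countable {..x::cord}"
  using countable_lessThan_cord[of x] by (simp add: ivl_disj_un_singleton(2)[symmetric])

lemma uncountable_UNIV_cord: "uncountable (UNIV :: cord set)"
proof
  assume "countable (UNIV :: cord set)"
  then obtain f :: "cord \<Rightarrow> nat" where f: "inj f"
    by (auto simp: countable_def)
  define W where "W = {(x, y::cord). x \<le> y}"
  have FW: "Field W = UNIV"
    by (auto simp: W_def Field_def)
  have wfW: "wf (W - Id)"
  proof -
    have "W - Id = {(x, y). x < y}"
      by (auto simp: W_def)
    then show ?thesis
      by (simp add: wf)
  qed
  have W: "Well_order W"
    unfolding well_order_on_def linear_order_on_def partial_order_on_def preorder_on_def FW
    using wfW by (auto simp: W_def refl_on_def trans_def antisym_def total_on_def)
  define D where "D = dir_image W f"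
  have D: "Well_order D"
    unfolding D_def using W f by (intro Well_order_dir_image) (auto intro: inj_on_subset)
  have FD: "Field D = range f"
    by (simp add: D_def dir_image_Field FW)
  have DI: "(f x, f y) \<in> D \<longleftrightarrow> x \<le> y" for x y
    using f by (auto simp: D_def dir_image_def W_def inj_def)
  define h where "h x = abs_cord (Restr D (underS D (f x)))" for x
  have wo: "Well_order (Restr D A)" for A
    using D by (rule Well_order_Restr)
  have fil: "wo_rel.ofilter D (underS D a)" for a
    using D by (simp add: wo_rel_def wo_rel.underS_ofilter)
  have h_less: "h x < abs_cord D" for x
    unfolding h_def using D FD by (auto simp: abs_cord_less wo intro!: underS_Restr_ordLess)
  have "h x < h y" if "x < y" for x y
  proof -
    have "underS D (f x) \<subset> underS D (f y)"
    proof -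
      have "(b, f z) \<in> D \<longleftrightarrow> b \<in> f ` {..z}" for b z
        using f by (auto simp: D_def dir_image_def W_def dest: injD)
      then have "underS D (f z) = f ` {..<z}" for z
        using f by (auto simp: underS_def inj_eq order_less_le)
      moreover have "{..<x} \<subset> {..<y}"
        using that by auto
      ultimately show ?thesis
        using f by (metis inj_image_subset_iff less_le_not_le)
    qed
    then show ?thesis
      unfolding h_def abs_cord_less[OF wo wo] using ofilter_subset_ordLess[OF D fil fil] by blast
  qed
  moreover have "h (abs_cord D) < abs_cord D"
    by (rule h_less)
  moreover have "\<not> h x < x" for x
    by (induction x rule: less_induct) (use calculation(1) in blast)
  ultimately show False
    by blast
qed

lemma countable_bdd_above:
  assumes "countable (S :: cord set)"
  shows "bdd_above S"
proof (rule ccontr)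
  assume "\<not> bdd_above S"
  then have "(\<Union>x\<in>S. {..x}) = UNIV"
    by (auto simp: bdd_above_def not_le) (meson less_imp_le)
  moreover have "countable (\<Union>x\<in>S. {..x})"
    using assms by (auto intro: countable_atMost_cord)
  ultimately show False
    using uncountable_UNIV_cord by simp
qed

instantiation cord :: "{zero, one}"
begin

definition zero_cord :: cord
  where "zero_cord = abs_cord {}"

definition cord_succ :: "cord \<Rightarrow> cord"
  where "cord_succ x = (LEAST y. x < y)"

definition one_cord :: cord
  where "one_cord = cord_succ 0"

instance ..

end

lemma cord_zero_le: "0 \<le> (x::cord)"
proof -
  have "Well_order ({} :: nat rel)"
    by simp
  then show ?thesis
    by (cases x rule: cord_cases)
      (auto simp: zero_cord_def abs_cord_le ordLeq_def embed_def bij_betw_def Field_def)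
qed

lemma cord_less_succ: "x < cord_succ x"
proof -
  have "\<exists>y. x < y"
    using countable_atMost_cord[of x] uncountable_UNIV_cord
    by (metis UNIV_eq_I atMost_iff not_le)
  then show ?thesis
    unfolding cord_succ_def by (rule LeastI_ex)
qed

lemma cord_succ_le_iff: "cord_succ x \<le> y \<longleftrightarrow> x < y"
  by (metis Least_le cord_less_succ cord_succ_def less_le_trans)

lemma cord_Sup_le_iff:
  assumes "countable (S :: cord set)"
  shows "Sup S \<le> y \<longleftrightarrow> (\<forall>x\<in>S. x \<le> y)"
proof
  show "\<forall>x\<in>S. x \<le> y" if "Sup S \<le> y"
    using that cSup_upper[OF _ countable_bdd_above[OF assms]] by (auto intro: order_trans)
  show "Sup S \<le> y" if "\<forall>x\<in>S. x \<le> y"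
    using that Least_le[of "\<lambda>y. \<forall>x\<in>S. x \<le> y" y] by (simp add: Sup_cord_def)
qed

text \<open>Addition, multiplication and powers of \<open>\<omega>\<close> by transfinite recursion in the uniform format
  \<open>x + y = sup ({x} \<union> {(x + z) + 1 | z < y})\<close>, \<open>x \<cdot> y = sup {x \<cdot> z + x | z < y}\<close> and
  \<open>\<omega>\<^sup>y = sup ({1} \<union> {\<omega>\<^sup>z \<cdot> \<omega> | z < y})\<close>.\<close>

instantiation cord :: plus
begin

function plus_cord :: "cord \<Rightarrow> cord \<Rightarrow> cord"
  where "plus_cord x y = Sup (insert x ((\<lambda>z. cord_succ (plus_cord x z)) ` {..<y}))"
  by pat_completeness auto
termination
proof (relation "inv_image {(x, y). x < y} snd")
  show "wf (inv_image {(x, y::cord). x < y} (snd :: cord \<times> cord \<Rightarrow> cord))"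
    by (rule wf_inv_image[OF wf])
qed simp

declare plus_cord.simps [simp del]

instance ..

end

instantiation cord :: times
begin

function times_cord :: "cord \<Rightarrow> cord \<Rightarrow> cord"
  where "times_cord x y = Sup ((\<lambda>z. times_cord x z + x) ` {..<y})"
  by pat_completeness auto
termination
proof (relation "inv_image {(x, y). x < y} snd")
  show "wf (inv_image {(x, y::cord). x < y} (snd :: cord \<times> cord \<Rightarrow> cord))"
    by (rule wf_inv_image[OF wf])
qed simp

declare times_cord.simps [simp del]

instance ..

end

primrec cord_of_nat :: "nat \<Rightarrow> cord"
  where
    "cord_of_nat 0 = 0"
  | "cord_of_nat (Suc n) = cord_succ (cord_of_nat n)"

definition cord_omega :: cord
  where "cord_omega = Sup (range cord_of_nat)"

function omega_power :: "cord \<Rightarrow> cord"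
  where "omega_power y = Sup (insert 1 ((\<lambda>z. omega_power z * cord_omega) ` {..<y}))"
  by pat_completeness auto
termination
proof (relation "{(x, y). x < y}")
  show "wf {(x, y::cord). x < y}"
    by (rule wf)
qed simp

declare omega_power.simps [simp del]

lemma cord_add_zero: "x + 0 = (x::cord)"
proof -
  have "{..<0::cord} = {}"
    using leD[OF cord_zero_le] by auto
  then show ?thesis
    by (subst plus_cord.simps) simp
qed

lemma cord_add_one: "x + 1 = cord_succ x"
proof -
  have "{..<1::cord} = {0}"
    unfolding one_cord_def
    by (auto simp: cord_less_succ) (meson cord_succ_le_iff cord_zero_le not_less antisym)
  then have "x + 1 = Sup {x, cord_succ x}"
    by (subst plus_cord.simps) (simp add: cord_add_zero)
  also have "\<dots> = cord_succ x"
    using less_imp_le[OF cord_less_succ[of x]] by (intro cSup_eq_maximum) auto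
  finally show ?thesis .
qed


section \<open>Trees\<close>

definition hereditary :: "nat list set \<Rightarrow> bool"
  where "hereditary \<Lambda> \<longleftrightarrow> (\<forall>s t. prefix s t \<and> t \<in> \<Lambda> \<longrightarrow> s \<in> \<Lambda>)"

definition leaves :: "nat list set \<Rightarrow> nat list set"
  where "leaves \<Lambda> = {s \<in> \<Lambda>. \<not> (\<exists>t\<in>\<Lambda>. strict_prefix s t)}"

definition non_leaves :: "nat list set \<Rightarrow> nat list set"
  where "non_leaves \<Lambda> = \<Lambda> - leaves \<Lambda>"

definition no_infinite_branch :: "nat list set \<Rightarrow> bool"
  where "no_infinite_branch \<Lambda> \<longleftrightarrow>
    \<not> (\<exists>b :: nat \<Rightarrow> nat list. (\<forall>n. b n \<in> \<Lambda> \<and> strict_prefix (b n) (b (Suc n))))"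

text \<open>The rank function is only meaningful on trees without infinite branches, see
  \<open>node_rank_unfold\<close>.\<close>

definition node_rank :: "nat list set \<Rightarrow> nat list \<Rightarrow> cord"
  where "node_rank \<Lambda> = wfrec {(t, s). s \<in> \<Lambda> \<and> t \<in> \<Lambda> \<and> strict_prefix s t}
    (\<lambda>r s. if s \<in> leaves \<Lambda> then 0 else Sup {r t + 1 | t. t \<in> \<Lambda> \<and> strict_prefix s t})"

lemma node_rank_unfold:
  assumes "no_infinite_branch \<Lambda>" "s \<in> \<Lambda>"
  shows "node_rank \<Lambda> s =
    (if s \<in> leaves \<Lambda> then 0 else Sup {node_rank \<Lambda> t + 1 | t. t \<in> \<Lambda> \<and> strict_prefix s t})"
proof -
  let ?R = "{(t, s). s \<in> \<Lambda> \<and> t \<in> \<Lambda> \<and> strict_prefix s t}"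
  have "wf ?R"
    using assms(1) unfolding wf_iff_no_infinite_down_chain no_infinite_branch_def by auto
  moreover have "{cut (node_rank \<Lambda>) ?R s t + 1 | t. t \<in> \<Lambda> \<and> strict_prefix s t}
      = {node_rank \<Lambda> t + 1 | t. t \<in> \<Lambda> \<and> strict_prefix s t}"
    using assms(2) by (force simp: cut_def)
  ultimately show ?thesis
    unfolding node_rank_def by (subst wfrec) (simp_all add: node_rank_def)
qed

datatype tree_rank = Ord cord | Infinity

text \<open>\<open>Ord \<beta>\<close> is the rank of a tree only if \<open>\<beta>\<close> is a successor.\<close>

fun tree_of_rank :: "tree_rank \<Rightarrow> nat list set \<Rightarrow> bool"
  where
    "tree_of_rank (Ord \<beta>) \<Lambda> \<longleftrightarrow>
      hereditary \<Lambda> \<and> [] \<in> \<Lambda> \<and> no_infinite_branch \<Lambda> \<and>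
      \<beta> = node_rank \<Lambda> [] + 1 \<and>
      (\<forall>s\<in>\<Lambda>. s \<in> leaves \<Lambda> \<or> (\<forall>n. s @ [n] \<in> \<Lambda>)) \<and>
      (\<forall>s\<in>non_leaves \<Lambda>.
        (\<exists>\<gamma>. \<forall>n. node_rank \<Lambda> (s @ [n]) = \<gamma>) \<or> strict_mono (\<lambda>n. node_rank \<Lambda> (s @ [n])))"
  | "tree_of_rank Infinity \<Lambda> \<longleftrightarrow> \<Lambda> = UNIV"


section \<open>The spaces on trees\<close>

text \<open>A normed space of real-valued functions is given by its carrier, a set \<open>V\<close> of functions closed
  under the pointwise operations, and its norm. Functions on a set \<open>S\<close> of points are represented by
  functions on the whole type that vanish outside \<open>S\<close>.\<close>

definition tree_norm :: "nat list set \<Rightarrow> (nat list \<Rightarrow> real) \<Rightarrow> ereal"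
  where "tree_norm \<Lambda> a = (SUP t\<in>\<Lambda>. ereal \<bar>\<Sum>s | prefix s t. a s\<bar>)"

definition restr :: "('a \<Rightarrow> real) \<Rightarrow> 'a set \<Rightarrow> 'a \<Rightarrow> real"
  where "restr a \<Omega> = (\<lambda>s. if s \<in> \<Omega> then a s else 0)"

definition subtree :: "nat list set \<Rightarrow> nat list \<Rightarrow> nat list set"
  where "subtree \<Lambda> s = {t \<in> \<Lambda>. prefix s t}"

definition tree_space :: "nat list set \<Rightarrow> (nat list \<Rightarrow> real) set"
  where "tree_space \<Lambda> = {a. (\<forall>s. s \<notin> \<Lambda> \<longrightarrow> a s = 0) \<and>
    tree_norm \<Lambda> a < \<infinity> \<and>
    (\<forall>s\<in>non_leaves \<Lambda>. (\<lambda>n. tree_norm \<Lambda> (restr a (subtree \<Lambda> (s @ [n])))) \<longlonglongrightarrow> 0) \<and>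
    (\<lambda>n. tree_norm \<Lambda> (restr a {t \<in> \<Lambda>. length t \<ge> n})) \<longlonglongrightarrow> 0}"

definition tree_copies :: "nat \<Rightarrow> nat list set \<Rightarrow> (nat list \<times> nat) set"
  where "tree_copies m \<Lambda> = \<Lambda> \<times> {1..m}"

definition tree_space_power :: "nat \<Rightarrow> nat list set \<Rightarrow> (nat list \<times> nat \<Rightarrow> real) set"
  where "tree_space_power m \<Lambda> = {a. (\<forall>x. x \<notin> tree_copies m \<Lambda> \<longrightarrow> a x = 0) \<and>
    (\<forall>i\<in>{1..m}. (\<lambda>s. a (s, i)) \<in> tree_space \<Lambda>)}"

definition tree_power_norm :: "nat \<Rightarrow> nat list set \<Rightarrow> (nat list \<times> nat \<Rightarrow> real) \<Rightarrow> real"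
  where "tree_power_norm m \<Lambda> a = (MAX i\<in>{1..m}. real_of_ereal (tree_norm \<Lambda> (\<lambda>s. a (s, i))))"

definition tree_delta :: "nat list \<times> nat \<Rightarrow> (nat list \<times> nat \<Rightarrow> real) \<Rightarrow> real"
  where "tree_delta = (\<lambda>(s, i) a. \<Sum>t | prefix t s. a (t, i))"


section \<open>The metric on trees\<close>

text \<open>\<^term>\<open>True\<close> and \<^term>\<open>False\<close> stand for the digits \<open>1\<close> and \<open>0\<close>.\<close>

definition cantor_code :: "nat list \<Rightarrow> nat \<Rightarrow> bool"
  where "cantor_code s = (let w = concat (map (\<lambda>k. replicate k True @ [False]) s)
    in (\<lambda>n. if n < length w then w ! n else True))"

definition cantor_dist :: "(nat \<Rightarrow> bool) \<Rightarrow> (nat \<Rightarrow> bool) \<Rightarrow> real"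
  where "cantor_dist x y = (if x = y then 0 else (1 / 2) ^ (LEAST k. x k \<noteq> y k))"

definition tree_dist :: "nat list \<Rightarrow> nat list \<Rightarrow> real"
  where "tree_dist s t = cantor_dist (cantor_code s) (cantor_code t)"

definition copies_dist :: "nat list \<times> nat \<Rightarrow> nat list \<times> nat \<Rightarrow> real"
  where "copies_dist = (\<lambda>(s, i) (t, j). if i = j then tree_dist s t else 1)"


section \<open>Embeddings and projectional trees\<close>

definition linear_map_on :: "('a \<Rightarrow> real) set \<Rightarrow> (('a \<Rightarrow> real) \<Rightarrow> 'e::real_vector) \<Rightarrow> bool"
  where "linear_map_on V T \<longleftrightarrow>
    (\<forall>a\<in>V. \<forall>b\<in>V. T (\<lambda>x. a x + b x) = T a + T b) \<and>
    (\<forall>a\<in>V. \<forall>c. T (\<lambda>x. c * a x) = c *\<^sub>R T a)"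

definition isomorphic_embedding ::
    "('a \<Rightarrow> real) set \<Rightarrow> (('a \<Rightarrow> real) \<Rightarrow> real) \<Rightarrow> (('a \<Rightarrow> real) \<Rightarrow> 'e::real_normed_vector) \<Rightarrow> bool"
  where "isomorphic_embedding V N T \<longleftrightarrow> linear_map_on V T \<and>
    (\<exists>c>0. \<exists>C. \<forall>a\<in>V. c * N a \<le> norm (T a) \<and> norm (T a) \<le> C * N a)"

definition isometric_embedding ::
    "('a \<Rightarrow> real) set \<Rightarrow> (('a \<Rightarrow> real) \<Rightarrow> real) \<Rightarrow> (('a \<Rightarrow> real) \<Rightarrow> 'e::real_normed_vector) \<Rightarrow> bool"
  where "isometric_embedding V N T \<longleftrightarrow> linear_map_on V T \<and> (\<forall>a\<in>V. norm (T a) = N a)"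

definition unif_weak_star_continuous_on ::
    "'a set \<Rightarrow> ('a \<Rightarrow> 'a \<Rightarrow> real) \<Rightarrow> ('a \<Rightarrow> 'e::real_normed_vector \<Rightarrow>\<^sub>L real) \<Rightarrow> bool"
  where "unif_weak_star_continuous_on X d \<rho> \<longleftrightarrow>
    (\<forall>e x y. (\<forall>n::nat. x n \<in> X \<and> y n \<in> X) \<longrightarrow> (\<lambda>n. d (x n) (y n)) \<longlonglongrightarrow> 0 \<longrightarrow>
      (\<lambda>n. blinfun_apply (\<rho> (x n) - \<rho> (y n)) e) \<longlonglongrightarrow> 0)"

text \<open>For \<open>m \<ge> 1\<close> the index set \<open>tree_copies m \<Lambda>\<close> and the tree \<open>\<Lambda>\<close> determine each other; the
  triples are represented with \<open>\<Lambda>\<close> as their first component. Only the values of \<open>T\<close> on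
  \<open>tree_space_power m \<Lambda>\<close> and of \<open>\<rho>\<close> on \<open>tree_copies m \<Lambda>\<close> matter.\<close>

definition projectional_tree ::
    "tree_rank \<Rightarrow> nat \<Rightarrow> nat list set \<Rightarrow> ((nat list \<times> nat \<Rightarrow> real) \<Rightarrow> 'e::real_normed_vector)
      \<Rightarrow> (nat list \<times> nat \<Rightarrow> 'e \<Rightarrow>\<^sub>L real) \<Rightarrow> bool"
  where "projectional_tree \<beta> m \<Lambda> T \<rho> \<longleftrightarrow>
    tree_of_rank \<beta> \<Lambda> \<and>
    isomorphic_embedding (tree_space_power m \<Lambda>) (tree_power_norm m \<Lambda>) T \<and>
    unif_weak_star_continuous_on (tree_copies m \<Lambda>) copies_dist \<rho> \<and>
    bounded (\<rho> ` tree_copies m \<Lambda>) \<and>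
    (\<forall>x\<in>tree_copies m \<Lambda>. \<forall>a\<in>tree_space_power m \<Lambda>. blinfun_apply (\<rho> x) (T a) = tree_delta x a)"

definition isometric_projectional_tree ::
    "tree_rank \<Rightarrow> nat \<Rightarrow> nat list set \<Rightarrow> ((nat list \<times> nat \<Rightarrow> real) \<Rightarrow> 'e::real_normed_vector)
      \<Rightarrow> (nat list \<times> nat \<Rightarrow> 'e \<Rightarrow>\<^sub>L real) \<Rightarrow> bool"
  where "isometric_projectional_tree \<beta> m \<Lambda> T \<rho> \<longleftrightarrow>
    projectional_tree \<beta> m \<Lambda> T \<rho> \<and>
    isometric_embedding (tree_space_power m \<Lambda>) (tree_power_norm m \<Lambda>) T"


section \<open>Spaces of continuous functions and complemented subspaces\<close>

text \<open>In the applications \<open>L\<close> is the whole Cantor space \<^typ>\<open>nat \<Rightarrow> bool\<close> (with the product topology)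
  or an interval of \<^typ>\<open>cord\<close>; as intervals are order-convex, their subspace topology is their
  order topology.\<close>

definition cont_space :: "'a::topological_space set \<Rightarrow> ('a \<Rightarrow> real) set"
  where "cont_space L = {f. continuous_on L f \<and> (\<forall>x. x \<notin> L \<longrightarrow> f x = 0)}"

definition sup_norm :: "'a set \<Rightarrow> ('a \<Rightarrow> real) \<Rightarrow> real"
  where "sup_norm L f = (SUP x\<in>L. \<bar>f x\<bar>)"

definition complemented :: "'e::real_normed_vector set \<Rightarrow> bool"
  where "complemented F \<longleftrightarrow> subspace F \<and> closed F \<and>
    (\<exists>P. bounded_linear P \<and> (\<forall>x. P (P x) = P x) \<and> range P = F)"

definition cont_space_isometric_to :: "'a::topological_space set \<Rightarrow> 'e::real_normed_vector set \<Rightarrow> bool"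
  where "cont_space_isometric_to L F \<longleftrightarrow>
    (\<exists>J. isometric_embedding (cont_space L) (sup_norm L) J \<and> J ` cont_space L = F)"

end

theory Submission
  imports Defs
begin

text \<open>A family \<open>a\<close> on a tree is determined by its path sums \<open>f t = (\<Sum>s | prefix s t. a s)\<close>, and
the norm of \<open>a\<close> is the supremum of \<open>\<bar>f\<bar>\<close>. In terms of \<open>f\<close>, the limit condition at a node \<open>s\<close> is
continuity at \<open>s\<close> for the topology in which the subtrees above \<open>s @ [n]\<close> converge to \<open>s\<close>, and the
limit condition on levels says that \<open>f\<close> is almost constant above each node of a high level,
uniformly. Together they amount to uniform continuity for the metric inherited from the Cantor
space (\<open>mem_tree_space_iff\<close>). Hence the space on a tree is the space of uniformly continuous functions on it, that is, the space of
continuous functions on the closure of the set of codes of its nodes.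

Given this, the equivalence with projections is formal. If \<open>P\<close> is a projection onto an isometric
copy \<open>T ` A\<close> of the space \<open>A\<close> on the tree, then \<open>\<rho> x e\<close> is the value at \<open>x\<close> of the
uniformly continuous function that \<open>P e\<close> represents (\<open>projectional_tree_of_projection\<close>). Conversely,
uniform weak* continuity says that every \<open>x \<mapsto> \<rho> x e\<close> is uniformly continuous, hence represents an
element of \<open>A\<close>, whose image under \<open>T\<close> is the projection of \<open>e\<close>
(\<open>complemented_of_projectional_tree\<close>).

It remains to identify the closure of the codes. For the full tree it is the whole Cantor space,
because the codes are the sequences that are eventually \<open>1\<close> (\<open>cont_model_cantor\<close>). For a tree of
rank \<open>\<alpha> + 1\<close> the codes already form a closed set, and traversing the tree with every node after all
its extensions enumerates it by the ordinals from \<open>1\<close> to \<open>\<omega>\<^sup>\<alpha>\<close>: the children of a node contribute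
consecutive blocks of lengths \<open>\<omega>\<close> to the powers of their ranks, and these lengths add up to \<open>\<omega>\<close> to the power of the rank of the node (\<open>cont_model_ordinal\<close>). Trees of every
rank exist (\<open>exists_tree_of_rank\<close>), which is needed to pass from the projection to a projectional
tree.\<close>

section \<open>Ordinal arithmetic\<close>

lemma cord_less_Sup_iff:
  assumes "countable (S :: cord set)"
  shows "y < Sup S \<longleftrightarrow> (\<exists>x\<in>S. y < x)"
  using cord_Sup_le_iff[OF assms, of y] by (meson not_le)

lemma cord_less_succ_iff: "x < cord_succ y \<longleftrightarrow> x \<le> y"
  using cord_succ_le_iff[of y x] by (meson not_le)

text \<open>Sums, products and powers are suprema, so the only convenient access to them is through their sets
of strict lower bounds; most identities below are proved by comparing these sets.\<close>

lemma cord_le_by_less: "(\<And>u. u < x \<Longrightarrow> u < y) \<Longrightarrow> x \<le> (y::cord)"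
  using less_irrefl not_le by blast

lemma cord_eq_by_less: "(\<And>u. u < x \<longleftrightarrow> u < y) \<Longrightarrow> x = (y::cord)"
  by (intro antisym cord_le_by_less) auto

lemma cord_one_le_iff: "(1::cord) \<le> x \<longleftrightarrow> 0 < x"
  by (simp add: one_cord_def cord_succ_le_iff)

lemma cord_less_add_iff: "u < x + y \<longleftrightarrow> u < x \<or> (\<exists>z<y. u \<le> x + z)" for u x y :: cord
proof -
  have "countable (insert x ((\<lambda>z. cord_succ (x + z)) ` {..<y}))"
    by (simp add: countable_lessThan_cord)
  from cord_less_Sup_iff[OF this, of u] show ?thesis
    unfolding plus_cord.simps[of x y] by (auto simp: cord_less_succ_iff)
qed

lemma cord_less_times_iff: "u < x * y \<longleftrightarrow> (\<exists>z<y. u < x * z + x)" for u x y :: cord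
proof -
  have "countable ((\<lambda>z. x * z + x) ` {..<y})"
    by (simp add: countable_lessThan_cord)
  from cord_less_Sup_iff[OF this, of u] show ?thesis
    unfolding times_cord.simps[of x y] by auto
qed

lemma cord_less_omega_power_iff:
  "u < omega_power y \<longleftrightarrow> u = 0 \<or> (\<exists>z<y. u < omega_power z * cord_omega)"
proof -
  have "countable (insert 1 ((\<lambda>z. omega_power z * cord_omega) ` {..<y}))"
    by (simp add: countable_lessThan_cord)
  from cord_less_Sup_iff[OF this, of u] show ?thesis
    unfolding omega_power.simps[of y] using cord_zero_le[of u]
    by (auto simp: one_cord_def cord_less_succ_iff)
qed

lemma cord_le_add: "x \<le> x + (y::cord)"
  by (rule cord_le_by_less) (simp add: cord_less_add_iff)

lemma cord_add_strict_mono: "y < z \<Longrightarrow> x + y < x + (z::cord)"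
  using cord_less_add_iff by blast

lemma cord_add_mono_right: "y \<le> z \<Longrightarrow> x + y \<le> x + (z::cord)"
  using cord_add_strict_mono by (metis order_le_less)

lemma cord_add_mono_left: "x \<le> y \<Longrightarrow> x + z \<le> y + (z::cord)"
proof (induction z rule: less_induct)
  case (less z)
  have "u < y + z" if u: "u < x + z" for u
  proof (cases "u < x")
    case True
    then show ?thesis
      using less.prems cord_less_add_iff by (auto intro: order_less_le_trans)
  next
    case False
    then obtain v where v: "v < z" "u \<le> x + v"
      using u cord_less_add_iff[of u x z] by blast
    have "u \<le> y + v"
      using v(2) less.IH[OF v(1) less.prems] by (rule order_trans)
    with v(1) show ?thesis
      using cord_less_add_iff[of u y z] by blast
  qed
  then show ?case by (rule cord_le_by_less)
qed

lemma cord_add_mono: "x \<le> y \<Longrightarrow> u \<le> v \<Longrightarrow> x + u \<le> y + (v::cord)"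
  by (rule order_trans[OF cord_add_mono_left cord_add_mono_right])

lemma cord_add_assoc: "(x + y) + z = x + (y + (z::cord))"
proof (induction z rule: less_induct)
  case (less z)
  have "u < (x + y) + z \<longleftrightarrow> u < x + (y + z)" for u
  proof -
    have "u < (x + y) + z \<longleftrightarrow> u < x + y \<or> (\<exists>v<z. u \<le> x + (y + v))"
      using less by (auto simp: cord_less_add_iff[of u "x + y"])
    also have "\<dots> \<longleftrightarrow> u < x \<or> (\<exists>v<y + z. u \<le> x + v)"
    proof
      assume "u < x + y \<or> (\<exists>v<z. u \<le> x + (y + v))"
      then show "u < x \<or> (\<exists>v<y + z. u \<le> x + v)"
      proof
        assume "u < x + y"
        then show ?thesis
          using order_less_le_trans[OF _ cord_le_add[of y z]] cord_less_add_iff[of u x y] by blast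
      next
        assume "\<exists>v<z. u \<le> x + (y + v)"
        then show ?thesis
          using cord_add_strict_mono by blast
      qed
    next
      assume "u < x \<or> (\<exists>v<y + z. u \<le> x + v)"
      then show "u < x + y \<or> (\<exists>v<z. u \<le> x + (y + v))"
      proof
        assume "u < x"
        then show ?thesis
          using cord_le_add[of x y] by (auto dest: order_less_le_trans)
      next
        assume "\<exists>v<y + z. u \<le> x + v"
        then obtain v where v: "v < y + z" "u \<le> x + v" by blast
        show ?thesis
        proof (cases "v < y")
          case True
          then show ?thesis
            using order_le_less_trans[OF v(2) cord_add_strict_mono[of v y x]] by blast
        next
          case False
          then obtain w where w: "w < z" "v \<le> y + w"
            using v cord_less_add_iff[of v y z] by blast
          have "u \<le> x + (y + w)"
            using v(2) cord_add_mono_right[OF w(2)] by (rule order_trans)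
          with w(1) show ?thesis by blast
        qed
      qed
    qed
    also have "\<dots> \<longleftrightarrow> u < x + (y + z)"
      by (simp add: cord_less_add_iff)
    finally show ?thesis .
  qed
  then show ?case by (rule cord_eq_by_less)
qed

lemma cord_zero_add: "0 + x = (x::cord)"
proof (induction x rule: less_induct)
  case (less x)
  have "u < 0 + x \<longleftrightarrow> u < x" for u
    using less cord_zero_le[of u] by (auto simp: cord_less_add_iff[of u] intro: order_le_less_trans)
  then show ?case by (rule cord_eq_by_less)
qed

lemma cord_times_mono_right: "y \<le> z \<Longrightarrow> x * y \<le> x * (z::cord)"
  by (rule cord_le_by_less) (auto simp: cord_less_times_iff intro: order_less_le_trans)

lemma cord_times_mono_left: "x \<le> y \<Longrightarrow> x * z \<le> y * (z::cord)"
proof (induction z rule: less_induct)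
  case (less z)
  have "u < y * z" if u: "u < x * z" for u
  proof -
    obtain v where v: "v < z" "u < x * v + x"
      using u cord_less_times_iff[of u x z] by blast
    then have "x * v + x \<le> y * v + y"
      using less by (intro cord_add_mono) auto
    then show ?thesis
      using v(1) order_less_le_trans[OF v(2)] cord_less_times_iff[of u y z] by blast
  qed
  then show ?case by (rule cord_le_by_less)
qed

lemma cord_times_zero: "x * 0 = (0::cord)"
  using leD[OF cord_zero_le] by (intro cord_eq_by_less) (simp add: cord_less_times_iff)

lemma cord_times_succ: "x * cord_succ y = x * y + (x::cord)"
proof -
  have "u < x * cord_succ y \<longleftrightarrow> u < x * y + x" for u
  proof
    assume "u < x * cord_succ y"
    then obtain z where z: "z \<le> y" "u < x * z + x"
      by (auto simp: cord_less_times_iff[of u] cord_less_succ_iff)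
    then show "u < x * y + x"
      using order_less_le_trans[OF z(2) cord_add_mono_left[OF cord_times_mono_right[OF z(1)]]] by blast
  next
    assume "u < x * y + x"
    then show "u < x * cord_succ y"
      using cord_less_succ[of y] cord_less_times_iff[of u x "cord_succ y"] by blast
  qed
  then show ?thesis by (rule cord_eq_by_less)
qed

lemma cord_less_times_omega_iff: "u < x * cord_omega \<longleftrightarrow> (\<exists>n. u < x * cord_of_nat n)" for u x :: cord
proof
  assume "u < x * cord_omega"
  then obtain z where z: "z < cord_omega" "u < x * z + x"
    by (auto simp: cord_less_times_iff[of u])
  then obtain n where "z < cord_of_nat n"
    by (auto simp: cord_omega_def cord_less_Sup_iff)
  then have "u < x * cord_of_nat n"
    using z cord_less_times_iff[of u x "cord_of_nat n"] by blast
  then show "\<exists>n. u < x * cord_of_nat n" ..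
next
  assume "\<exists>n. u < x * cord_of_nat n"
  then obtain n where n: "u < x * cord_of_nat n" ..
  have "cord_of_nat n \<le> cord_omega"
    unfolding cord_omega_def by (intro cSup_upper countable_bdd_above) auto
  then show "u < x * cord_omega"
    using order_less_le_trans[OF n cord_times_mono_right] by blast
qed

lemma omega_power_pos: "0 < omega_power y"
  by (simp add: cord_less_omega_power_iff)

lemma omega_power_mono: "y \<le> z \<Longrightarrow> omega_power y \<le> omega_power z"
  by (rule cord_le_by_less) (auto simp: cord_less_omega_power_iff intro: order_less_le_trans)

lemma omega_power_zero: "omega_power 0 = 1"
proof -
  have "u < omega_power 0 \<longleftrightarrow> u < 1" for u
    using leD[OF cord_zero_le] cord_zero_le[of u]
    by (auto simp: cord_less_omega_power_iff one_cord_def cord_less_succ_iff)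
  then show ?thesis by (rule cord_eq_by_less)
qed

lemma cord_less_add_omega_power: "x < x + omega_power y"
  using cord_add_strict_mono[OF omega_power_pos[of y], of x] by (simp add: cord_add_zero)

primrec omega_power_sum :: "(nat \<Rightarrow> cord) \<Rightarrow> nat \<Rightarrow> cord"
  where
    "omega_power_sum g 0 = 0"
  | "omega_power_sum g (Suc n) = omega_power_sum g n + omega_power (g n)"

text \<open>A sum of \<open>n\<close> powers with increasing exponents is at most \<open>\<omega>\<^sup>e \<cdot> n\<close> with \<open>e\<close> the next exponent \<open>g n\<close>,
and this is below \<open>\<omega>\<^sup>e \<cdot> \<omega>\<close>, which is at most \<open>\<omega>\<^sup>y\<close> because \<open>e < y\<close>. Monotonicity of the exponents covers
constant and strictly increasing sequences at once.\<close>

lemma omega_power_sum_less: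
  assumes "mono g" "\<And>n. g n < y"
  shows "omega_power_sum g n < omega_power y"
proof -
  have "omega_power_sum g n \<le> omega_power (g n) * cord_of_nat n"
  proof (induction n)
    case (Suc n)
    have "omega_power_sum g (Suc n) \<le> omega_power (g n) * cord_of_nat (Suc n)"
      using Suc by (simp add: cord_times_succ cord_add_mono_left)
    also have "\<dots> \<le> omega_power (g (Suc n)) * cord_of_nat (Suc n)"
      by (intro cord_times_mono_left omega_power_mono monoD[OF assms(1)]) simp
    finally show ?case .
  qed (simp add: cord_zero_le)
  also have "\<dots> < omega_power (g n) * cord_of_nat (Suc n)"
    by (simp add: cord_times_succ cord_less_add_omega_power)
  finally have "omega_power_sum g n < omega_power (g n) * cord_omega"
    unfolding cord_less_times_omega_iff ..
  then show ?thesis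
    using assms(2) cord_less_omega_power_iff by blast
qed

text \<open>An ordinal below \<open>\<omega>\<^sup>y\<close> is below some \<open>\<omega>\<^sup>z \<cdot> k\<close> with \<open>z < y\<close>, and from some index on every summand is
at least \<open>\<omega>\<^sup>z\<close>, so that \<open>k\<close> of them suffice.\<close>

lemma omega_power_sum_cofinal:
  assumes "mono g" "\<And>z. z < y \<Longrightarrow> \<exists>n. z \<le> g n" "u < omega_power y"
  shows "\<exists>n. u < omega_power_sum g n"
proof (cases "u = 0")
  case True
  then have "u < omega_power_sum g (Suc 0)"
    by (simp add: cord_zero_add omega_power_pos)
  then show ?thesis ..
next
  case False
  then obtain z k where z: "z < y" "u < omega_power z * cord_of_nat k"
    using assms(3) by (auto simp: cord_less_omega_power_iff cord_less_times_omega_iff)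
  obtain n where n: "z \<le> g n"
    using assms(2) z by blast
  have "omega_power z * cord_of_nat j \<le> omega_power_sum g (n + j)" for j
  proof (induction j)
    case (Suc j)
    have "z \<le> g (n + j)"
      using n monoD[OF assms(1), of n "n + j"] by simp
    then show ?case
      using Suc by (simp add: cord_times_succ cord_add_mono omega_power_mono)
  qed (simp add: cord_times_zero cord_zero_le)
  then show ?thesis
    using order_less_le_trans[OF z(2)] by blast
qed

section \<open>Uniform continuity along codes\<close>

definition code_length :: "nat list \<Rightarrow> nat"
  where "code_length s = sum_list (map Suc s)"

lemma length_le_code_length: "length s \<le> code_length s"
  by (induction s) (auto simp: code_length_def)

lemma cantor_code_Nil [simp]: "cantor_code [] j"
  by (simp add: cantor_code_def)

lemma cantor_code_Cons:
  "cantor_code (n # t) j = (if j < n then True else if j = n then False else cantor_code t (j - Suc n))"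
  by (auto simp: cantor_code_def Let_def nth_append nth_Cons' not_less)

lemma cantor_code_append:
  "cantor_code (s @ t) j =
    (if j < code_length s then cantor_code s j else cantor_code t (j - code_length s))"
  by (induction s arbitrary: j) (auto simp: code_length_def cantor_code_Cons diff_diff_left)

lemma cantor_code_beyond: "code_length s \<le> j \<Longrightarrow> cantor_code s j"
  using cantor_code_append[of s "[]" j] by simp

text \<open>Two nodes are close in the metric of the tree iff their codes agree on a long initial segment.
Working with this relation avoids all arithmetic with the powers of \<open>1 / 2\<close>.\<close>

definition codes_agree :: "nat \<Rightarrow> nat list \<Rightarrow> nat list \<Rightarrow> bool"
  where "codes_agree k s t \<longleftrightarrow> (\<forall>j<k. cantor_code s j = cantor_code t j)"

lemma codes_agree_mono: "codes_agree k s t \<Longrightarrow> l \<le> k \<Longrightarrow> codes_agree l s t"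
  by (auto simp: codes_agree_def)

lemma codes_agree_extension: "codes_agree (code_length s + n) s (s @ n # t)"
  by (auto simp: codes_agree_def cantor_code_append cantor_code_Cons cantor_code_beyond not_less)

text \<open>Beyond the code of \<open>s\<close>, the code of \<open>s @ n # t\<close> has its first zero at position \<open>n\<close>; a code that
agrees with it up to there must branch off in the same direction.\<close>

lemma codes_agree_same_child:
  assumes "codes_agree k (s @ n # t) (s @ u)" "code_length s + n < k"
  shows "\<exists>v. u = n # v"
proof -
  have *: "cantor_code (n # t) j = cantor_code u j" if "j \<le> n" for j
  proof -
    have "code_length s + j < k"
      using that assms(2) by simp
    with assms(1) have "cantor_code (s @ n # t) (code_length s + j) = cantor_code (s @ u) (code_length s + j)"
      unfolding codes_agree_def by blast
    then show ?thesis
      by (simp add: cantor_code_append)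
  qed
  show ?thesis
  proof (cases u)
    case Nil
    then show ?thesis
      using *[of n] by (simp add: cantor_code_Cons)
  next
    case (Cons m v)
    then have "m = n"
      using *[of n] *[of m] by (auto simp: cantor_code_Cons split: if_splits)
    with Cons show ?thesis by simp
  qed
qed

definition code_unif_cont :: "nat list set \<Rightarrow> (nat list \<Rightarrow> real) \<Rightarrow> bool"
  where "code_unif_cont \<Lambda> f \<longleftrightarrow>
    (\<forall>\<epsilon>>0. \<exists>k. \<forall>s\<in>\<Lambda>. \<forall>t\<in>\<Lambda>. codes_agree k s t \<longrightarrow> \<bar>f s - f t\<bar> < \<epsilon>)"

text \<open>With \<open>f\<close> the path sums of a family, \<open>node_cont\<close> and \<open>level_cont\<close> are the two limit conditions in the
definition of \<open>tree_space\<close>, at a node and on levels.\<close>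

definition node_cont :: "nat list set \<Rightarrow> (nat list \<Rightarrow> real) \<Rightarrow> nat list \<Rightarrow> bool"
  where "node_cont \<Lambda> f s \<longleftrightarrow>
    (\<forall>\<epsilon>>0. \<exists>N. \<forall>n\<ge>N. \<forall>t\<in>\<Lambda>. prefix (s @ [n]) t \<longrightarrow> \<bar>f t - f s\<bar> < \<epsilon>)"

definition level_cont :: "nat list set \<Rightarrow> (nat list \<Rightarrow> real) \<Rightarrow> bool"
  where "level_cont \<Lambda> f \<longleftrightarrow>
    (\<forall>\<epsilon>>0. \<exists>N. \<forall>n\<ge>N. \<forall>t\<in>\<Lambda>. n \<le> length t \<longrightarrow> \<bar>f t - f (take n t)\<bar> < \<epsilon>)"

lemma code_unif_contD:
  assumes "code_unif_cont \<Lambda> f" "\<epsilon> > 0"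
  obtains k where "\<And>s t. s \<in> \<Lambda> \<Longrightarrow> t \<in> \<Lambda> \<Longrightarrow> codes_agree k s t \<Longrightarrow> \<bar>f s - f t\<bar> < \<epsilon>"
  using assms unfolding code_unif_cont_def by blast

lemma code_unif_cont_node_cont:
  assumes "code_unif_cont \<Lambda> f" "s \<in> \<Lambda>"
  shows "node_cont \<Lambda> f s"
  unfolding node_cont_def
proof (intro allI impI)
  fix \<epsilon> :: real assume "\<epsilon> > 0"
  then obtain k where k: "\<And>s t. s \<in> \<Lambda> \<Longrightarrow> t \<in> \<Lambda> \<Longrightarrow> codes_agree k s t \<Longrightarrow> \<bar>f s - f t\<bar> < \<epsilon>"
    using code_unif_contD[OF assms(1)] by blast
  have "\<bar>f t - f s\<bar> < \<epsilon>" if t: "n \<ge> k" "t \<in> \<Lambda>" "prefix (s @ [n]) t" for n t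
  proof -
    obtain u where "t = s @ n # u"
      using t(3) by (auto simp: prefix_def)
    then have "codes_agree k s t"
      using codes_agree_mono[OF codes_agree_extension[of s n u]] t(1) by simp
    then show ?thesis
      using k[of s t] assms(2) t(2) by (simp add: abs_minus_commute)
  qed
  then show "\<exists>N. \<forall>n\<ge>N. \<forall>t\<in>\<Lambda>. prefix (s @ [n]) t \<longrightarrow> \<bar>f t - f s\<bar> < \<epsilon>"
    by blast
qed

lemma hereditary_take: "hereditary \<Lambda> \<Longrightarrow> t \<in> \<Lambda> \<Longrightarrow> take n t \<in> \<Lambda>"
  using take_is_prefix by (auto simp: hereditary_def)

lemma code_unif_cont_level_cont:
  assumes "code_unif_cont \<Lambda> f" "hereditary \<Lambda>"
  shows "level_cont \<Lambda> f"
  unfolding level_cont_def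
proof (intro allI impI)
  fix \<epsilon> :: real assume "\<epsilon> > 0"
  then obtain k where k: "\<And>s t. s \<in> \<Lambda> \<Longrightarrow> t \<in> \<Lambda> \<Longrightarrow> codes_agree k s t \<Longrightarrow> \<bar>f s - f t\<bar> < \<epsilon>"
    using code_unif_contD[OF assms(1)] by blast
  have "\<bar>f t - f (take n t)\<bar> < \<epsilon>" if "n \<ge> k" "t \<in> \<Lambda>" "n \<le> length t" for n t
  proof -
    have "k \<le> code_length (take n t)"
      using length_le_code_length[of "take n t"] that by simp
    then have "codes_agree k t (take n t)"
      using cantor_code_append[of "take n t" "drop n t"] by (auto simp: codes_agree_def)
    then show ?thesis
      using k that hereditary_take[OF assms(2)] by blast
  qed
  then show "\<exists>N. \<forall>n\<ge>N. \<forall>t\<in>\<Lambda>. n \<le> length t \<longrightarrow> \<bar>f t - f (take n t)\<bar> < \<epsilon>"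
    by blast
qed

text \<open>There are only finitely many initial segments of codes of a given length, so the metric on a tree
is totally bounded.\<close>

lemma code_unif_cont_bounded:
  assumes "code_unif_cont \<Lambda> f"
  obtains B where "\<And>t. t \<in> \<Lambda> \<Longrightarrow> \<bar>f t\<bar> \<le> B"
proof -
  obtain k where k: "\<And>s t. s \<in> \<Lambda> \<Longrightarrow> t \<in> \<Lambda> \<Longrightarrow> codes_agree k s t \<Longrightarrow> \<bar>f s - f t\<bar> < 1"
    using code_unif_contD[OF assms, of 1] by auto
  define p where "p t = map (cantor_code t) [0..<k]" for t
  have "p ` \<Lambda> \<subseteq> {xs. set xs \<subseteq> UNIV \<and> length xs = k}"
    by (auto simp: p_def)
  then have fin: "finite (p ` \<Lambda>)"
    by (rule finite_subset) (rule finite_lists_length_eq, simp)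
  define r where "r = inv_into \<Lambda> p"
  define B where "B = (\<Sum>q\<in>p ` \<Lambda>. \<bar>f (r q)\<bar>) + 1"
  have "\<bar>f t\<bar> \<le> B" if t: "t \<in> \<Lambda>" for t
  proof -
    have r: "r (p t) \<in> \<Lambda>" "p (r (p t)) = p t"
      using t by (auto simp: r_def inv_into_into f_inv_into_f)
    then have "codes_agree k t (r (p t))"
      by (auto simp: p_def codes_agree_def)
    then have "\<bar>f t - f (r (p t))\<bar> < 1"
      using k t r by blast
    moreover have "\<bar>f (r (p t))\<bar> \<le> (\<Sum>q\<in>p ` \<Lambda>. \<bar>f (r q)\<bar>)"
      using fin t by (intro member_le_sum) auto
    ultimately show ?thesis
      by (simp add: B_def)
  qed
  then show thesis
    using that by blast
qed

text \<open>Uniform continuity at one precision \<open>\<epsilon>\<close>, restricted to the part of the tree above \<open>s\<close>. This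
localisation can be passed from the children of a node to the node.\<close>

definition small_oscillation :: "nat list set \<Rightarrow> (nat list \<Rightarrow> real) \<Rightarrow> real \<Rightarrow> nat list \<Rightarrow> bool"
  where "small_oscillation \<Lambda> f \<epsilon> s \<longleftrightarrow>
    (\<exists>k. \<forall>t\<in>subtree \<Lambda> s. \<forall>u\<in>subtree \<Lambda> s. codes_agree k t u \<longrightarrow> \<bar>f t - f u\<bar> < \<epsilon>)"

lemma code_unif_cont_iff_small_oscillation:
  "code_unif_cont \<Lambda> f \<longleftrightarrow> (\<forall>\<epsilon>>0. small_oscillation \<Lambda> f \<epsilon> [])"
  by (simp add: code_unif_cont_def small_oscillation_def subtree_def)

text \<open>Continuity at \<open>s\<close> controls all children of \<open>s\<close> except finitely many, and these finitely many have a
common precision. Two nodes with sufficiently long common code lie above the same exceptional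
child, or both are close to \<open>s\<close>.\<close>

lemma small_oscillation_step:
  assumes "node_cont \<Lambda> f s" "\<epsilon> > 0" "\<And>n. small_oscillation \<Lambda> f \<epsilon> (s @ [n])"
  shows "small_oscillation \<Lambda> f \<epsilon> s"
proof -
  obtain N where N: "\<And>n t. n \<ge> N \<Longrightarrow> t \<in> \<Lambda> \<Longrightarrow> prefix (s @ [n]) t \<Longrightarrow> \<bar>f t - f s\<bar> < \<epsilon> / 2"
    using assms(1,2) unfolding node_cont_def by (meson half_gt_zero)
  have "\<forall>n. \<exists>k. \<forall>t\<in>subtree \<Lambda> (s @ [n]). \<forall>u\<in>subtree \<Lambda> (s @ [n]). codes_agree k t u \<longrightarrow> \<bar>f t - f u\<bar> < \<epsilon>"
    using assms(3) unfolding small_oscillation_def by blast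
  then obtain k where k: "\<And>n t u. t \<in> subtree \<Lambda> (s @ [n]) \<Longrightarrow> u \<in> subtree \<Lambda> (s @ [n]) \<Longrightarrow>
      codes_agree (k n) t u \<Longrightarrow> \<bar>f t - f u\<bar> < \<epsilon>"
    by metis
  define K where "K = code_length s + N + sum k {..<N}"
  have child: "\<bar>f t - f u\<bar> < \<epsilon>" 
    if tu: "codes_agree K t u" "n < N" "t \<in> subtree \<Lambda> (s @ [n])" "u \<in> subtree \<Lambda> s" for t u n
  proof -
    have "k n \<le> sum k {..<N}"
      using that(2) by (intro member_le_sum) auto
    then have K: "k n \<le> K" "code_length s + n < K"
      using that(2) by (auto simp: K_def)
    obtain t' u' where split: "t = s @ n # t'" "u = s @ u'"
      using tu(3,4) by (auto simp: subtree_def prefix_def)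
    with tu(1) K(2) obtain v where "u' = n # v"
      using codes_agree_same_child by blast
    with split tu have "u \<in> subtree \<Lambda> (s @ [n])"
      by (auto simp: subtree_def)
    with k tu K(1) codes_agree_mono show ?thesis
      by blast
  qed
  have near: "\<bar>f t - f s\<bar> < \<epsilon> / 2 \<or> (\<exists>n<N. t \<in> subtree \<Lambda> (s @ [n]))" 
    if t: "t \<in> subtree \<Lambda> s" for t
  proof -
    obtain v where v: "t = s @ v"
      using t by (auto simp: subtree_def prefix_def)
    show ?thesis
    proof (cases v)
      case Nil
      with v assms(2) show ?thesis by simp
    next
      case (Cons n w)
      with v t have "t \<in> subtree \<Lambda> (s @ [n])"
        by (auto simp: subtree_def)
      with N[of n t] show ?thesis
        by (cases "n < N") (auto simp: subtree_def)
    qed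
  qed
  have "\<bar>f t - f u\<bar> < \<epsilon>" if tu: "t \<in> subtree \<Lambda> s" "u \<in> subtree \<Lambda> s" "codes_agree K t u" for t u
  proof (cases "\<exists>n<N. t \<in> subtree \<Lambda> (s @ [n]) \<or> u \<in> subtree \<Lambda> (s @ [n])")
    case True
    moreover have "codes_agree K u t"
      using tu(3) by (auto simp: codes_agree_def)
    ultimately show ?thesis
      using child[of t u] child[of u t] tu by (auto simp: abs_minus_commute)
  next
    case False
    then have "\<bar>f t - f s\<bar> < \<epsilon> / 2" "\<bar>f u - f s\<bar> < \<epsilon> / 2"
      using near tu by blast+
    then show ?thesis
      by linarith
  qed
  then show ?thesis
    unfolding small_oscillation_def by blast
qed

lemma well_founded_tree_induct [consumes 2]:
  assumes "no_infinite_branch \<Lambda>" "s \<in> \<Lambda>"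
    and step: "\<And>s. s \<in> \<Lambda> \<Longrightarrow> (\<And>t. t \<in> \<Lambda> \<Longrightarrow> strict_prefix s t \<Longrightarrow> P t) \<Longrightarrow> P s"
  shows "P s"
proof -
  let ?R = "{(t, s). s \<in> \<Lambda> \<and> t \<in> \<Lambda> \<and> strict_prefix s t}"
  have "wf ?R"
    using assms(1) unfolding wf_iff_no_infinite_down_chain no_infinite_branch_def by auto
  then have "s \<in> \<Lambda> \<longrightarrow> P s"
    by (induction s rule: wf_induct_rule) (use step in blast)
  with assms(2) show ?thesis by simp
qed

lemma small_oscillation_outside:
  assumes "hereditary \<Lambda>" "s \<notin> \<Lambda>"
  shows "small_oscillation \<Lambda> f \<epsilon> s"
proof -
  have "subtree \<Lambda> s = {}"
    using assms by (auto simp: subtree_def hereditary_def)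
  then show ?thesis
    by (simp add: small_oscillation_def)
qed

text \<open>This is the compactness of the set of codes of a tree without infinite branches: continuity at
every node is automatically uniform.\<close>

lemma node_cont_code_unif_cont_well_founded:
  assumes "hereditary \<Lambda>" "no_infinite_branch \<Lambda>" "\<And>s. s \<in> \<Lambda> \<Longrightarrow> node_cont \<Lambda> f s"
  shows "code_unif_cont \<Lambda> f"
  unfolding code_unif_cont_iff_small_oscillation
proof (intro allI impI)
  fix \<epsilon> :: real assume "\<epsilon> > 0"
  have "small_oscillation \<Lambda> f \<epsilon> s" if "s \<in> \<Lambda>" for s
    using assms(2) that
  proof (induction s rule: well_founded_tree_induct)
    case (1 s)
    have "small_oscillation \<Lambda> f \<epsilon> (s @ [n])" for n
      using 1(2)[of "s @ [n]"] small_oscillation_outside[OF assms(1)]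
      by (cases "s @ [n] \<in> \<Lambda>") (auto simp: strict_prefix_def)
    then show ?case
      using small_oscillation_step assms(3) 1(1) \<open>\<epsilon> > 0\<close> by blast
  qed
  then show "small_oscillation \<Lambda> f \<epsilon> []"
    using small_oscillation_outside[OF assms(1)] by blast
qed

text \<open>The condition on levels makes \<open>f\<close> oscillate little on the whole part of the tree above any node of
some level \<open>N\<close>; from there the step lemma descends to the root.\<close>

lemma node_cont_level_cont_code_unif_cont:
  assumes "hereditary \<Lambda>" "\<And>s. s \<in> \<Lambda> \<Longrightarrow> node_cont \<Lambda> f s" "level_cont \<Lambda> f"
  shows "code_unif_cont \<Lambda> f"
  unfolding code_unif_cont_iff_small_oscillation
proof (intro allI impI)
  fix \<epsilon> :: real assume "\<epsilon> > 0"
  then obtain N where N: "\<And>t. t \<in> \<Lambda> \<Longrightarrow> N \<le> length t \<Longrightarrow> \<bar>f t - f (take N t)\<bar> < \<epsilon> / 2"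
    using assms(3) unfolding level_cont_def by (meson half_gt_zero order_refl)
  have "\<forall>s. length s = n \<longrightarrow> small_oscillation \<Lambda> f \<epsilon> s" if "n \<le> N" for n
    using that
  proof (induction n rule: inc_induct)
    case base
    show ?case
    proof (intro allI impI)
      fix s :: "nat list" assume s: "length s = N"
      have "\<bar>f t - f s\<bar> < \<epsilon> / 2" if "t \<in> subtree \<Lambda> s" for t
        using that N[of t] s by (auto simp: subtree_def prefix_def)
      then have "\<bar>f t - f u\<bar> < \<epsilon>" if "t \<in> subtree \<Lambda> s" "u \<in> subtree \<Lambda> s" for t u
        using that by (smt (verit) field_sum_of_halves)
      then show "small_oscillation \<Lambda> f \<epsilon> s"
        unfolding small_oscillation_def by blast
    qed
  next
    case (step n)
    show ?case
    proof (intro allI impI)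
      fix s :: "nat list" assume "length s = n"
      then have "small_oscillation \<Lambda> f \<epsilon> (s @ [i])" for i
        using step by simp
      then show "small_oscillation \<Lambda> f \<epsilon> s"
        using small_oscillation_step[OF assms(2) \<open>\<epsilon> > 0\<close>] small_oscillation_outside[OF assms(1)]
        by blast
    qed
  qed
  then show "small_oscillation \<Lambda> f \<epsilon> []"
    by (metis le0 list.size(3))
qed

section \<open>The spaces on trees as spaces of uniformly continuous functions\<close>

definition path_sum :: "(nat list \<Rightarrow> real) \<Rightarrow> nat list \<Rightarrow> real"
  where "path_sum a t = (\<Sum>s | prefix s t. a s)"

lemma finite_prefixes: "finite {s. prefix s t}"
  by (metis List.finite_set set_prefixes_eq)

lemma path_sum_Nil [simp]: "path_sum a [] = a []"
  by (simp add: path_sum_def)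

lemma path_sum_snoc [simp]: "path_sum a (t @ [n]) = path_sum a t + a (t @ [n])"
proof -
  have "{s. prefix s (t @ [n])} = insert (t @ [n]) {s. prefix s t}"
    by auto
  moreover have "\<not> prefix (t @ [n]) t"
    by (auto dest: prefix_length_le)
  ultimately show ?thesis
    by (simp add: path_sum_def finite_prefixes)
qed

lemma hereditaryD: "hereditary \<Lambda> \<Longrightarrow> s @ t \<in> \<Lambda> \<Longrightarrow> s \<in> \<Lambda>"
  unfolding hereditary_def by (meson prefixI)

text \<open>The restrictions of a family that occur in the definition of \<open>tree_space\<close> have differences of path
sums as their path sums, which is why the limit conditions there speak about the oscillation of
\<open>path_sum a\<close>.\<close>

lemma path_sum_restr_subtree:
  assumes "hereditary \<Lambda>" "t \<in> \<Lambda>"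
  shows "path_sum (restr a (subtree \<Lambda> (s @ [n]))) t =
    (if prefix (s @ [n]) t then path_sum a t - path_sum a s else 0)"
  using assms(2)
proof (induction t rule: rev_induct)
  case Nil
  then show ?case by (simp add: restr_def subtree_def)
next
  case (snoc m t)
  have "t \<in> \<Lambda>"
    using hereditaryD[OF assms(1) snoc.prems] .
  moreover have "\<not> prefix (t @ [m]) t"
    by (auto dest: prefix_length_le)
  ultimately show ?case
    using snoc by (auto simp: restr_def subtree_def)
qed

lemma path_sum_restr_level:
  assumes "hereditary \<Lambda>" "t \<in> \<Lambda>"
  shows "path_sum (restr a {r \<in> \<Lambda>. Suc n \<le> length r}) t = path_sum a t - path_sum a (take n t)"
  using assms(2)
proof (induction t rule: rev_induct)
  case Nil
  then show ?case by (simp add: restr_def)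
next
  case (snoc m t)
  have "t \<in> \<Lambda>"
    using hereditaryD[OF assms(1) snoc.prems] .
  then show ?case
    using snoc by (cases "n \<le> length t") (auto simp: restr_def)
qed

lemma tree_norm_le_iff: "tree_norm \<Lambda> a \<le> ereal B \<longleftrightarrow> (\<forall>t\<in>\<Lambda>. \<bar>path_sum a t\<bar> \<le> B)"
  by (simp add: tree_norm_def path_sum_def SUP_le_iff)

lemma tree_norm_nonneg: "[] \<in> \<Lambda> \<Longrightarrow> 0 \<le> tree_norm \<Lambda> a"
  unfolding tree_norm_def by (rule SUP_upper2[of "[]"]) auto

lemma tree_norm_tendsto_zero_iff:
  assumes "[] \<in> \<Lambda>"
  shows "(\<lambda>n. tree_norm \<Lambda> (a n)) \<longlonglongrightarrow> 0 \<longleftrightarrow>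
    (\<forall>\<epsilon>>0. \<exists>N::nat. \<forall>n\<ge>N. \<forall>t\<in>\<Lambda>. \<bar>path_sum (a n) t\<bar> < \<epsilon>)" (is "?L \<longleftrightarrow> ?R")
proof
  assume L: ?L
  show ?R
  proof (intro allI impI)
    fix \<epsilon> :: real assume "\<epsilon> > 0"
    then have "\<forall>\<^sub>F n in sequentially. tree_norm \<Lambda> (a n) < ereal \<epsilon>"
      using L by (intro order_tendstoD(2)[of _ 0]) auto
    then obtain N where N: "\<And>n. n \<ge> N \<Longrightarrow> tree_norm \<Lambda> (a n) < ereal \<epsilon>"
      by (auto simp: eventually_sequentially)
    have "\<bar>path_sum (a n) t\<bar> < \<epsilon>" if "n \<ge> N" "t \<in> \<Lambda>" for n t
    proof -
      have "ereal \<bar>path_sum (a n) t\<bar> \<le> tree_norm \<Lambda> (a n)"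
        unfolding tree_norm_def path_sum_def by (rule SUP_upper) (rule that)
      also have "\<dots> < ereal \<epsilon>"
        by (rule N) (rule that)
      finally show ?thesis by simp
    qed
    then show "\<exists>N. \<forall>n\<ge>N. \<forall>t\<in>\<Lambda>. \<bar>path_sum (a n) t\<bar> < \<epsilon>"
      by blast
  qed
next
  assume R: ?R
  show ?L
  proof (rule order_tendstoI)
    fix c :: ereal assume "c < 0"
    then show "\<forall>\<^sub>F n in sequentially. c < tree_norm \<Lambda> (a n)"
      using tree_norm_nonneg[OF assms] by (intro always_eventually) (auto intro: less_le_trans)
  next
    fix c :: ereal assume "0 < c"
    then obtain \<epsilon> where \<epsilon>: "0 < ereal \<epsilon>" "ereal \<epsilon> < c"
      using ereal_dense2 by blast
    then have "\<epsilon> > 0" by simp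
    then obtain N where N: "\<forall>n\<ge>N. \<forall>t\<in>\<Lambda>. \<bar>path_sum (a n) t\<bar> < \<epsilon>"
      using R by blast
    have "tree_norm \<Lambda> (a n) < c" if "n \<ge> N" for n
    proof -
      have "tree_norm \<Lambda> (a n) \<le> ereal \<epsilon>"
        using N that by (auto simp: tree_norm_le_iff intro: less_imp_le)
      with \<epsilon>(2) show ?thesis by simp
    qed
    then show "\<forall>\<^sub>F n in sequentially. tree_norm \<Lambda> (a n) < c"
      by (auto simp: eventually_sequentially)
  qed
qed

lemma tree_norm_subtree_tendsto_zero_iff:
  assumes "hereditary \<Lambda>" "[] \<in> \<Lambda>"
  shows "(\<lambda>n. tree_norm \<Lambda> (restr a (subtree \<Lambda> (s @ [n])))) \<longlonglongrightarrow> 0 \<longleftrightarrow> node_cont \<Lambda> (path_sum a) s"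
  unfolding tree_norm_tendsto_zero_iff[OF assms(2)] node_cont_def
  by (intro arg_cong[of _ _ All] ext imp_cong refl arg_cong[of _ _ Ex] ball_cong)
    (simp add: path_sum_restr_subtree[OF assms(1)])

lemma tree_norm_level_tendsto_zero_iff:
  assumes "hereditary \<Lambda>" "[] \<in> \<Lambda>"
  shows "(\<lambda>n. tree_norm \<Lambda> (restr a {t \<in> \<Lambda>. length t \<ge> n})) \<longlonglongrightarrow> 0 \<longleftrightarrow> level_cont \<Lambda> (path_sum a)"
proof -
  have "(\<lambda>n. tree_norm \<Lambda> (restr a {t \<in> \<Lambda>. length t \<ge> n})) \<longlonglongrightarrow> 0 \<longleftrightarrow>
      (\<lambda>n. tree_norm \<Lambda> (restr a {t \<in> \<Lambda>. length t \<ge> Suc n})) \<longlonglongrightarrow> 0"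
    by (rule filterlim_sequentially_Suc[symmetric])
  also have "\<dots> \<longleftrightarrow> level_cont \<Lambda> (path_sum a)"
    \<comment> \<open>shifting by one matches the levels \<open>length t \<ge> Suc n\<close> with the truncation \<open>take n t\<close>\<close>
    unfolding tree_norm_tendsto_zero_iff[OF assms(2)] level_cont_def
  proof (intro arg_cong[of _ _ All] ext imp_cong refl arg_cong[of _ _ Ex] ball_cong)
    fix \<epsilon> :: real and n :: nat and t assume "\<epsilon> > 0" "t \<in> \<Lambda>"
    then show "\<bar>path_sum (restr a {t \<in> \<Lambda>. Suc n \<le> length t}) t\<bar> < \<epsilon> \<longleftrightarrow>
        (n \<le> length t \<longrightarrow> \<bar>path_sum a t - path_sum a (take n t)\<bar> < \<epsilon>)"
      using path_sum_restr_level[OF assms(1), of t a n] by auto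
  qed
  finally show ?thesis .
qed

text \<open>The path sums turn the space on a tree into the space of uniformly continuous functions. Every
function is continuous at a leaf, since nothing converges to it.\<close>

lemma mem_tree_space_iff:
  assumes "hereditary \<Lambda>" "[] \<in> \<Lambda>"
  shows "a \<in> tree_space \<Lambda> \<longleftrightarrow> (\<forall>s. s \<notin> \<Lambda> \<longrightarrow> a s = 0) \<and> code_unif_cont \<Lambda> (path_sum a)"
proof -
  have "a \<in> tree_space \<Lambda> \<longleftrightarrow> (\<forall>s. s \<notin> \<Lambda> \<longrightarrow> a s = 0) \<and> tree_norm \<Lambda> a < \<infinity> \<and>
      (\<forall>s\<in>non_leaves \<Lambda>. node_cont \<Lambda> (path_sum a) s) \<and> level_cont \<Lambda> (path_sum a)"
    by (simp add: tree_space_def tree_norm_subtree_tendsto_zero_iff[OF assms]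
        tree_norm_level_tendsto_zero_iff[OF assms])
  moreover have "code_unif_cont \<Lambda> (path_sum a)"
    if "\<forall>s\<in>non_leaves \<Lambda>. node_cont \<Lambda> (path_sum a) s" "level_cont \<Lambda> (path_sum a)"
  proof (rule node_cont_level_cont_code_unif_cont[OF assms(1) _ that(2)])
    fix s assume s: "s \<in> \<Lambda>"
    show "node_cont \<Lambda> (path_sum a) s"
    proof (cases "s \<in> non_leaves \<Lambda>")
      case True
      with that(1) show ?thesis by blast
    next
      case False
      then have "\<not> prefix (s @ [n]) t" if "t \<in> \<Lambda>" for n t
        using s that by (auto simp: non_leaves_def leaves_def dest: prefix_snocD)
      then show ?thesis
        by (auto simp: node_cont_def)
    qed
  qed
  moreover have "tree_norm \<Lambda> a < \<infinity>" if "code_unif_cont \<Lambda> (path_sum a)"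
  proof -
    obtain B where "\<And>t. t \<in> \<Lambda> \<Longrightarrow> \<bar>path_sum a t\<bar> \<le> B"
      using code_unif_cont_bounded[OF \<open>code_unif_cont \<Lambda> (path_sum a)\<close>] by blast
    then have "tree_norm \<Lambda> a \<le> ereal B"
      by (simp add: tree_norm_le_iff)
    then show ?thesis
      by (auto intro: le_less_trans)
  qed
  ultimately show ?thesis
    using code_unif_cont_node_cont code_unif_cont_level_cont[OF _ assms(1)]
    by (auto simp: non_leaves_def)
qed

text \<open>The inverse of \<open>path_sum\<close>: a function on the tree is the family of path sums of its increments
along the branches.\<close>

definition increments :: "nat list set \<Rightarrow> (nat list \<Rightarrow> real) \<Rightarrow> nat list \<Rightarrow> real"
  where "increments \<Lambda> f s = (if s \<in> \<Lambda> then f s - (if s = [] then 0 else f (butlast s)) else 0)"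

lemma path_sum_increments:
  assumes "hereditary \<Lambda>" "t \<in> \<Lambda>"
  shows "path_sum (increments \<Lambda> f) t = f t"
  using assms(2)
proof (induction t rule: rev_induct)
  case (snoc m t)
  then show ?case
    using hereditaryD[OF assms(1) snoc.prems] by (simp add: increments_def)
qed (simp add: increments_def)

lemma increments_path_sum:
  assumes "\<forall>s. s \<notin> \<Lambda> \<longrightarrow> a s = 0"
  shows "increments \<Lambda> (path_sum a) = a"
proof
  fix s show "increments \<Lambda> (path_sum a) s = a s"
    using assms by (cases s rule: rev_cases) (auto simp: increments_def)
qed

lemma increments_cong:
  assumes "hereditary \<Lambda>" "\<And>s. s \<in> \<Lambda> \<Longrightarrow> f s = g s"
  shows "increments \<Lambda> f = increments \<Lambda> g"
proof
  fix s show "increments \<Lambda> f s = increments \<Lambda> g s"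
    using assms hereditaryD[OF assms(1)] by (cases s rule: rev_cases) (auto simp: increments_def)
qed

lemma code_unif_cont_cong:
  "(\<And>s. s \<in> \<Lambda> \<Longrightarrow> f s = g s) \<Longrightarrow> code_unif_cont \<Lambda> f \<longleftrightarrow> code_unif_cont \<Lambda> g"
  by (simp add: code_unif_cont_def)

definition copies_unif_cont :: "nat \<Rightarrow> nat list set \<Rightarrow> (nat list \<times> nat \<Rightarrow> real) \<Rightarrow> bool"
  where "copies_unif_cont m \<Lambda> f \<longleftrightarrow> (\<forall>i\<in>{1..m}. code_unif_cont \<Lambda> (\<lambda>s. f (s, i)))"

lemma copies_unif_cont_cong:
  "(\<And>x. x \<in> tree_copies m \<Lambda> \<Longrightarrow> f x = g x) \<Longrightarrow> copies_unif_cont m \<Lambda> f \<longleftrightarrow> copies_unif_cont m \<Lambda> g"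
  unfolding copies_unif_cont_def tree_copies_def
  by (intro ball_cong refl code_unif_cont_cong) auto

lemma tree_delta_eq_path_sum: "tree_delta (s, i) a = path_sum (\<lambda>t. a (t, i)) s"
  by (simp add: tree_delta_def path_sum_def)

lemma tree_delta_add: "tree_delta x (\<lambda>y. a y + b y) = tree_delta x a + tree_delta x b"
  by (cases x) (simp add: tree_delta_def sum.distrib)

lemma tree_delta_mult: "tree_delta x (\<lambda>y. c * a y) = c * tree_delta x a"
  by (cases x) (simp add: tree_delta_def sum_distrib_left)

lemma mem_tree_space_power_iff:
  assumes "hereditary \<Lambda>" "[] \<in> \<Lambda>"
  shows "a \<in> tree_space_power m \<Lambda> \<longleftrightarrow>
    (\<forall>x. x \<notin> tree_copies m \<Lambda> \<longrightarrow> a x = 0) \<and> copies_unif_cont m \<Lambda> (\<lambda>x. tree_delta x a)"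
  by (auto simp: tree_space_power_def mem_tree_space_iff[OF assms] copies_unif_cont_def
      tree_delta_eq_path_sum tree_copies_def)

lemma tree_space_power_eqI:
  assumes "hereditary \<Lambda>" "a \<in> tree_space_power m \<Lambda>" "b \<in> tree_space_power m \<Lambda>"
    and "\<And>x. x \<in> tree_copies m \<Lambda> \<Longrightarrow> tree_delta x a = tree_delta x b"
  shows "a = b"
proof
  fix x :: "nat list \<times> nat"
  obtain s i where x: "x = (s, i)" by (cases x)
  show "a x = b x"
  proof (cases "x \<in> tree_copies m \<Lambda>")
    case True
    then have i: "i \<in> {1..m}" by (simp add: x tree_copies_def)
    have "(\<lambda>t. a (t, i)) = increments \<Lambda> (path_sum (\<lambda>t. a (t, i)))"
      using assms(2) by (intro increments_path_sum[symmetric]) (auto simp: tree_space_power_def tree_copies_def)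
    also have "\<dots> = increments \<Lambda> (path_sum (\<lambda>t. b (t, i)))"
      using assms(4) i by (intro increments_cong[OF assms(1)])
        (auto simp: tree_copies_def tree_delta_eq_path_sum[symmetric])
    also have "\<dots> = (\<lambda>t. b (t, i))"
      using assms(3) by (intro increments_path_sum) (auto simp: tree_space_power_def tree_copies_def)
    finally show ?thesis
      unfolding x by (rule fun_cong)
  next
    case False
    with assms(2,3) show ?thesis
      by (simp add: tree_space_power_def x)
  qed
qed

definition copies_increments :: "nat \<Rightarrow> nat list set \<Rightarrow> (nat list \<times> nat \<Rightarrow> real) \<Rightarrow> nat list \<times> nat \<Rightarrow> real"
  where "copies_increments m \<Lambda> f = (\<lambda>(s, i). if i \<in> {1..m} then increments \<Lambda> (\<lambda>t. f (t, i)) s else 0)"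

lemma tree_delta_copies_increments:
  assumes "hereditary \<Lambda>" "x \<in> tree_copies m \<Lambda>"
  shows "tree_delta x (copies_increments m \<Lambda> f) = f x"
  using assms path_sum_increments[OF assms(1)]
  by (cases x) (auto simp: tree_copies_def tree_delta_eq_path_sum copies_increments_def)

lemma copies_increments_mem:
  assumes "hereditary \<Lambda>" "[] \<in> \<Lambda>" "copies_unif_cont m \<Lambda> f"
  shows "copies_increments m \<Lambda> f \<in> tree_space_power m \<Lambda>"
proof -
  have "copies_unif_cont m \<Lambda> (\<lambda>x. tree_delta x (copies_increments m \<Lambda> f))"
    using assms(3) tree_delta_copies_increments[OF assms(1)]
    by (subst copies_unif_cont_cong[where g = f]) auto
  then show ?thesis
    by (auto simp: mem_tree_space_power_iff[OF assms(1,2)] copies_increments_def tree_copies_def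
        increments_def)
qed

lemma code_unif_cont_add:
  assumes "code_unif_cont \<Lambda> f" "code_unif_cont \<Lambda> g"
  shows "code_unif_cont \<Lambda> (\<lambda>s. f s + g s)"
  unfolding code_unif_cont_def
proof (intro allI impI)
  fix \<epsilon> :: real assume "\<epsilon> > 0"
  then have "\<epsilon> / 2 > 0" by simp
  obtain k where k: "\<And>s t. s \<in> \<Lambda> \<Longrightarrow> t \<in> \<Lambda> \<Longrightarrow> codes_agree k s t \<Longrightarrow> \<bar>f s - f t\<bar> < \<epsilon> / 2"
    using code_unif_contD[OF assms(1) \<open>\<epsilon> / 2 > 0\<close>] by blast
  obtain l where l: "\<And>s t. s \<in> \<Lambda> \<Longrightarrow> t \<in> \<Lambda> \<Longrightarrow> codes_agree l s t \<Longrightarrow> \<bar>g s - g t\<bar> < \<epsilon> / 2"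
    using code_unif_contD[OF assms(2) \<open>\<epsilon> / 2 > 0\<close>] by blast
  have "\<bar>f s + g s - (f t + g t)\<bar> < \<epsilon>" if "s \<in> \<Lambda>" "t \<in> \<Lambda>" "codes_agree (max k l) s t" for s t
    using k[OF that(1,2) codes_agree_mono[OF that(3)]] l[OF that(1,2) codes_agree_mono[OF that(3)]]
    by (simp add: abs_if split: if_splits)
  then show "\<exists>k. \<forall>s\<in>\<Lambda>. \<forall>t\<in>\<Lambda>. codes_agree k s t \<longrightarrow> \<bar>f s + g s - (f t + g t)\<bar> < \<epsilon>"
    by blast
qed

lemma code_unif_cont_mult:
  assumes "code_unif_cont \<Lambda> f"
  shows "code_unif_cont \<Lambda> (\<lambda>s. c * f s)"
  unfolding code_unif_cont_def
proof (intro allI impI)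
  fix \<epsilon> :: real assume "\<epsilon> > 0"
  then have "\<epsilon> / (\<bar>c\<bar> + 1) > 0" by (simp add: add_nonneg_pos)
  then obtain k where k: "\<And>s t. s \<in> \<Lambda> \<Longrightarrow> t \<in> \<Lambda> \<Longrightarrow> codes_agree k s t \<Longrightarrow> \<bar>f s - f t\<bar> < \<epsilon> / (\<bar>c\<bar> + 1)"
    using code_unif_contD[OF assms] by blast
  have "\<bar>c * f s - c * f t\<bar> < \<epsilon>" if "s \<in> \<Lambda>" "t \<in> \<Lambda>" "codes_agree k s t" for s t
  proof -
    have "\<bar>c * f s - c * f t\<bar> = \<bar>c\<bar> * \<bar>f s - f t\<bar>"
      by (simp add: abs_mult flip: right_diff_distrib)
    also have "\<dots> \<le> (\<bar>c\<bar> + 1) * \<bar>f s - f t\<bar>"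
      by (intro mult_right_mono) auto
    also have "\<dots> < \<epsilon>"
      using k[OF that] by (simp add: field_simps)
    finally show ?thesis .
  qed
  then show "\<exists>k. \<forall>s\<in>\<Lambda>. \<forall>t\<in>\<Lambda>. codes_agree k s t \<longrightarrow> \<bar>c * f s - c * f t\<bar> < \<epsilon>"
    by blast
qed

lemma tree_space_power_add:
  assumes "hereditary \<Lambda>" "[] \<in> \<Lambda>" "a \<in> tree_space_power m \<Lambda>" "b \<in> tree_space_power m \<Lambda>"
  shows "(\<lambda>x. a x + b x) \<in> tree_space_power m \<Lambda>"
  using assms(3,4) unfolding mem_tree_space_power_iff[OF assms(1,2)]
  by (auto simp: tree_delta_add copies_unif_cont_def intro: code_unif_cont_add)

lemma tree_space_power_mult:
  assumes "hereditary \<Lambda>" "[] \<in> \<Lambda>" "a \<in> tree_space_power m \<Lambda>"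
  shows "(\<lambda>x. c * a x) \<in> tree_space_power m \<Lambda>"
  using assms(3) unfolding mem_tree_space_power_iff[OF assms(1,2)]
  by (auto simp: tree_delta_mult copies_unif_cont_def intro: code_unif_cont_mult)

lemma tree_power_norm_le_iff:
  assumes "hereditary \<Lambda>" "[] \<in> \<Lambda>" "m \<ge> 1" "a \<in> tree_space_power m \<Lambda>"
  shows "tree_power_norm m \<Lambda> a \<le> B \<longleftrightarrow> (\<forall>x\<in>tree_copies m \<Lambda>. \<bar>tree_delta x a\<bar> \<le> B)"
proof -
  have "real_of_ereal (tree_norm \<Lambda> (\<lambda>s. a (s, i))) \<le> B \<longleftrightarrow> (\<forall>s\<in>\<Lambda>. \<bar>tree_delta (s, i) a\<bar> \<le> B)"
    if "i \<in> {1..m}" for i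
  proof -
    have "tree_norm \<Lambda> (\<lambda>s. a (s, i)) < \<infinity>"
      using assms(4) that by (auto simp: tree_space_power_def tree_space_def)
    then have "real_of_ereal (tree_norm \<Lambda> (\<lambda>s. a (s, i))) \<le> B \<longleftrightarrow> tree_norm \<Lambda> (\<lambda>s. a (s, i)) \<le> ereal B"
      using tree_norm_nonneg[OF assms(2), of "\<lambda>s. a (s, i)"]
      by (cases "tree_norm \<Lambda> (\<lambda>s. a (s, i))") auto
    then show ?thesis
      by (simp add: tree_norm_le_iff tree_delta_eq_path_sum)
  qed
  then show ?thesis
    using assms(3) by (subst tree_power_norm_def, subst Max_le_iff) (auto simp: tree_copies_def)
qed

section \<open>Uniform weak* continuity\<close>

lemma cantor_dist_le:
  assumes "\<And>j. j < k \<Longrightarrow> x j = y j"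
  shows "cantor_dist x y \<le> (1 / 2) ^ k"
proof (cases "x = y")
  case False
  then have "\<exists>j. x j \<noteq> y j" by auto
  then have "x (LEAST j. x j \<noteq> y j) \<noteq> y (LEAST j. x j \<noteq> y j)"
    by (rule LeastI_ex)
  then have "k \<le> (LEAST j. x j \<noteq> y j)"
    using assms by (meson not_le)
  with False show ?thesis
    by (auto simp: cantor_dist_def intro!: power_decreasing)
qed (simp add: cantor_dist_def)

lemma cantor_dist_nonneg: "0 \<le> cantor_dist x y"
  by (simp add: cantor_dist_def)

lemma cantor_dist_less:
  assumes "cantor_dist x y < (1 / 2) ^ k" "j < k"
  shows "x j = y j"
proof (rule ccontr)
  assume ne: "x j \<noteq> y j"
  then have "(LEAST j. x j \<noteq> y j) \<le> j"
    by (rule Least_le)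
  with assms(2) have "(LEAST j. x j \<noteq> y j) \<le> k"
    by simp
  then have "(1 / 2 :: real) ^ k \<le> (1 / 2) ^ (LEAST j. x j \<noteq> y j)"
    by (intro power_decreasing) auto
  with assms(1) ne show False
    by (auto simp: cantor_dist_def split: if_splits)
qed

text \<open>For a fixed vector \<open>e\<close> the condition on sequences is the sequential form of uniform continuity on
each copy of the tree; points of different copies have distance \<open>1\<close> and never get close.\<close>

lemma unif_weak_star_continuous_on_copies_iff:
  "unif_weak_star_continuous_on (tree_copies m \<Lambda>) copies_dist \<rho> \<longleftrightarrow>
    (\<forall>e. copies_unif_cont m \<Lambda> (\<lambda>x. blinfun_apply (\<rho> x) e))" (is "?L \<longleftrightarrow> ?R")
proof
  assume L: ?L
  show ?R
    unfolding copies_unif_cont_def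
  proof (intro allI ballI, rule ccontr)
    fix e i assume i: "i \<in> {1..m}" and "\<not> code_unif_cont \<Lambda> (\<lambda>s. blinfun_apply (\<rho> (s, i)) e)"
    then obtain \<epsilon> where \<epsilon>: "\<epsilon> > 0" "\<forall>k. \<exists>s\<in>\<Lambda>. \<exists>t\<in>\<Lambda>. codes_agree k s t \<and>
        \<epsilon> \<le> \<bar>blinfun_apply (\<rho> (s, i)) e - blinfun_apply (\<rho> (t, i)) e\<bar>"
      unfolding code_unif_cont_def by (metis not_le)
    then obtain s t where st: "\<And>k. s k \<in> \<Lambda>" "\<And>k. t k \<in> \<Lambda>" "\<And>k. codes_agree k (s k) (t k)"
      "\<And>k. \<epsilon> \<le> \<bar>blinfun_apply (\<rho> (s k, i)) e - blinfun_apply (\<rho> (t k, i)) e\<bar>"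
      by metis
    have "(\<lambda>k. copies_dist (s k, i) (t k, i)) \<longlonglongrightarrow> 0"
    proof (rule real_tendsto_sandwich[OF _ _ tendsto_const LIMSEQ_power_zero])
      show "\<forall>\<^sub>F k in sequentially. 0 \<le> copies_dist (s k, i) (t k, i)"
        by (simp add: copies_dist_def tree_dist_def cantor_dist_nonneg)
      show "\<forall>\<^sub>F k in sequentially. copies_dist (s k, i) (t k, i) \<le> (1 / 2) ^ k"
        using st(3) by (auto simp: copies_dist_def tree_dist_def codes_agree_def
            intro!: always_eventually cantor_dist_le)
    qed simp
    moreover have "\<forall>k. (s k, i) \<in> tree_copies m \<Lambda> \<and> (t k, i) \<in> tree_copies m \<Lambda>"
      using st(1,2) i by (simp add: tree_copies_def)
    ultimately have "(\<lambda>k. blinfun_apply (\<rho> (s k, i) - \<rho> (t k, i)) e) \<longlonglongrightarrow> 0"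
      using L unfolding unif_weak_star_continuous_on_def by meson
    then have "\<forall>\<^sub>F k in sequentially. \<bar>blinfun_apply (\<rho> (s k, i) - \<rho> (t k, i)) e\<bar> < \<epsilon>"
      using \<epsilon>(1) by (auto simp: tendsto_iff)
    then obtain k where "\<bar>blinfun_apply (\<rho> (s k, i) - \<rho> (t k, i)) e\<bar> < \<epsilon>"
      using eventually_happens' sequentially_bot by blast
    with st(4)[of k] show False
      by (simp add: blinfun.diff_left)
  qed
next
  assume R: ?R
  show ?L
    unfolding unif_weak_star_continuous_on_def
  proof (intro allI impI)
    fix e x y
    assume xy: "\<forall>n::nat. x n \<in> tree_copies m \<Lambda> \<and> y n \<in> tree_copies m \<Lambda>"
      and d: "(\<lambda>n. copies_dist (x n) (y n)) \<longlonglongrightarrow> 0"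
    show "(\<lambda>n. blinfun_apply (\<rho> (x n) - \<rho> (y n)) e) \<longlonglongrightarrow> 0"
    proof (rule tendstoI)
      fix \<epsilon> :: real assume "\<epsilon> > 0"
      have "\<forall>i\<in>{1..m}. \<exists>k. \<forall>s\<in>\<Lambda>. \<forall>t\<in>\<Lambda>. codes_agree k s t \<longrightarrow>
          \<bar>blinfun_apply (\<rho> (s, i)) e - blinfun_apply (\<rho> (t, i)) e\<bar> < \<epsilon>"
        using R \<open>\<epsilon> > 0\<close> unfolding copies_unif_cont_def code_unif_cont_def by blast
      then obtain k where k: "\<And>i s t. i \<in> {1..m} \<Longrightarrow> s \<in> \<Lambda> \<Longrightarrow> t \<in> \<Lambda> \<Longrightarrow> codes_agree (k i) s t \<Longrightarrow>
          \<bar>blinfun_apply (\<rho> (s, i)) e - blinfun_apply (\<rho> (t, i)) e\<bar> < \<epsilon>"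
        by metis
      define K where "K = sum k {1..m}"
      \<comment> \<open>closer than \<open>(1 / 2) ^ K \<le> 1\<close>, two points lie in the same copy\<close>
      have K1: "(1 / 2 :: real) ^ K \<le> 1"
        by (simp add: power_le_one)
      have "\<forall>\<^sub>F n in sequentially. copies_dist (x n) (y n) < (1 / 2) ^ K"
        by (rule order_tendstoD(2)[OF d]) simp
      then show "\<forall>\<^sub>F n in sequentially. dist (blinfun_apply (\<rho> (x n) - \<rho> (y n)) e) 0 < \<epsilon>"
      proof (rule eventually_mono)
        fix n assume n: "copies_dist (x n) (y n) < (1 / 2) ^ K"
        obtain s i t j where st: "x n = (s, i)" "y n = (t, j)"
          by (cases "x n", cases "y n")
        with n K1 have ij: "i = j" and ag: "cantor_dist (cantor_code s) (cantor_code t) < (1 / 2) ^ K"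
          by (auto simp: copies_dist_def tree_dist_def split: if_splits)
        have mem: "i \<in> {1..m}" "s \<in> \<Lambda>" "t \<in> \<Lambda>"
          using xy[rule_format, of n] st by (auto simp: tree_copies_def)
        then have "k i \<le> K"
          unfolding K_def by (intro member_le_sum) auto
        then have "codes_agree (k i) s t"
          using cantor_dist_less[OF ag] by (auto simp: codes_agree_def)
        with k mem show "dist (blinfun_apply (\<rho> (x n) - \<rho> (y n)) e) 0 < \<epsilon>"
          by (simp add: st flip: ij) (simp add: blinfun.diff_left)
      qed
    qed
  qed
qed

section \<open>Models of the function spaces on trees\<close>

text \<open>The map \<open>\<phi>\<close> exhibits \<open>K\<close> as the completion of the disjoint union of \<open>m\<close> copies of the tree, stated
in terms of functions only: continuous functions on \<open>K\<close> restrict along \<open>\<phi>\<close> to uniformly continuous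
ones, every uniformly continuous function arises in this way, and the range of \<open>\<phi>\<close> is large enough
to detect bounds. The last condition stands for density; it also makes the restriction injective
and isometric.\<close>

definition cont_model ::
    "nat \<Rightarrow> nat list set \<Rightarrow> 'k::topological_space set \<Rightarrow> (nat list \<times> nat \<Rightarrow> 'k) \<Rightarrow> bool"
  where "cont_model m \<Lambda> K \<phi> \<longleftrightarrow>
    \<phi> ` tree_copies m \<Lambda> \<subseteq> K \<and>
    (\<forall>g\<in>cont_space K. copies_unif_cont m \<Lambda> (\<lambda>x. g (\<phi> x))) \<and>
    (\<forall>f. copies_unif_cont m \<Lambda> f \<longrightarrow> (\<exists>g\<in>cont_space K. \<forall>x\<in>tree_copies m \<Lambda>. g (\<phi> x) = f x)) \<and>
    (\<forall>g\<in>cont_space K. \<forall>B. (\<forall>x\<in>tree_copies m \<Lambda>. \<bar>g (\<phi> x)\<bar> \<le> B) \<longrightarrow> (\<forall>y\<in>K. \<bar>g y\<bar> \<le> B))"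

section \<open>The Cantor space\<close>

definition cylinder :: "(nat \<Rightarrow> bool) \<Rightarrow> nat \<Rightarrow> (nat \<Rightarrow> bool) set"
  where "cylinder x k = {y. \<forall>j<k. y j = x j}"

lemma open_cylinder: "open (cylinder x k)"
proof -
  have "cylinder x k = (\<Inter>j<k. (\<lambda>y. y j) -` {x j})"
    by (auto simp: cylinder_def)
  moreover have "open ((\<lambda>y::nat \<Rightarrow> bool. y j) -` {x j})" for j
    by (intro open_vimage open_discrete continuous_on_product_coordinates)
  ultimately show ?thesis
    by (simp add: open_INT)
qed

lemma cylinder_in_open:
  assumes "open U" "x \<in> U"
  obtains k where "cylinder x k \<subseteq> U"
proof -
  have "openin (product_topology (\<lambda>_::nat. euclidean :: bool topology) UNIV) U"
    using assms(1) by (simp add: euclidean_product_topology)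
  then obtain X where X: "x \<in> (\<Pi>\<^sub>E i\<in>UNIV. X i)" "finite {i. X i \<noteq> (UNIV :: bool set)}"
    "(\<Pi>\<^sub>E i\<in>UNIV. X i) \<subseteq> U"
    using product_topology_open_contains_basis[of "\<lambda>_. euclidean" UNIV U x] assms(2) by auto
  obtain k where k: "\<forall>i\<in>{i. X i \<noteq> UNIV}. i < k"
    using finite_nat_set_iff_bounded X(2) by blast
  have "cylinder x k \<subseteq> (\<Pi>\<^sub>E i\<in>UNIV. X i)"
  proof
    fix y assume y: "y \<in> cylinder x k"
    have "y i \<in> X i" for i
      using X(1) k y by (cases "i < k") (auto simp: cylinder_def PiE_iff)
    then show "y \<in> (\<Pi>\<^sub>E i\<in>UNIV. X i)"
      by (simp add: PiE_iff)
  qed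
  then show thesis
    by (rule that[OF order_trans[OF _ X(3)]])
qed

lemma compact_cantor: "compact (UNIV :: (nat \<Rightarrow> bool) set)"
proof -
  have "compact_space (product_topology (\<lambda>_::nat. euclidean :: bool topology) UNIV)"
    unfolding compact_space_product_topology
    by (simp add: compact_space_def finite_imp_compact)
  then show ?thesis
    by (simp add: euclidean_product_topology compact_space_def)
qed

text \<open>Continuity on the Cantor space is uniform by compactness; the right-hand side is uniform continuity
expressed by initial segments, as for the nodes of trees.\<close>

lemma continuous_on_cantor_iff:
  fixes g :: "(nat \<Rightarrow> bool) \<Rightarrow> real"
  shows "continuous_on UNIV g \<longleftrightarrow> (\<forall>\<epsilon>>0. \<exists>k. \<forall>x. \<forall>y\<in>cylinder x k. \<bar>g y - g x\<bar> < \<epsilon>)" (is "?L \<longleftrightarrow> ?R")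
proof
  assume L: ?L
  show ?R
  proof (intro allI impI)
    fix \<epsilon> :: real assume "\<epsilon> > 0"
    have "\<exists>k. \<forall>y\<in>cylinder x k. \<bar>g y - g x\<bar> < \<epsilon> / 2" for x
    proof -
      have "open (g -` ball (g x) (\<epsilon> / 2))"
        using L by (intro open_vimage) auto
      moreover have "x \<in> g -` ball (g x) (\<epsilon> / 2)"
        using \<open>\<epsilon> > 0\<close> by simp
      ultimately obtain k where "cylinder x k \<subseteq> g -` ball (g x) (\<epsilon> / 2)"
        by (rule cylinder_in_open)
      then have "\<forall>y\<in>cylinder x k. \<bar>g y - g x\<bar> < \<epsilon> / 2"
        by (auto simp: dist_real_def abs_minus_commute)
      then show ?thesis ..
    qed
    then obtain k where k: "\<And>x y. y \<in> cylinder x (k x) \<Longrightarrow> \<bar>g y - g x\<bar> < \<epsilon> / 2"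
      by metis
    obtain D where D: "finite D" "(UNIV :: (nat \<Rightarrow> bool) set) \<subseteq> (\<Union>x\<in>D. cylinder x (k x))"
    proof (rule compactE_image[OF compact_cantor, of UNIV "\<lambda>x. cylinder x (k x)"])
      show "UNIV \<subseteq> (\<Union>x. cylinder x (k x))"
        by (auto simp: cylinder_def)
    qed (auto intro: open_cylinder)
    have "\<bar>g y - g z\<bar> < \<epsilon>" if y: "y \<in> cylinder z (sum k D)" for y z
    proof -
      obtain x where x: "x \<in> D" "z \<in> cylinder x (k x)"
        using D(2) by blast
      have "k x \<le> sum k D"
        using D(1) x(1) by (intro member_le_sum) auto
      with x(2) y have "y \<in> cylinder x (k x)"
        by (auto simp: cylinder_def)
      with x(2) k[of y x] k[of z x] show ?thesis
        by (simp add: abs_if split: if_splits)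
    qed
    then show "\<exists>k. \<forall>x. \<forall>y\<in>cylinder x k. \<bar>g y - g x\<bar> < \<epsilon>"
      by blast
  qed
next
  assume R: ?R
  have "\<exists>A. open A \<and> x \<in> A \<and> (\<forall>y\<in>UNIV. y \<in> A \<longrightarrow> g y \<in> B)" if B: "open B" "g x \<in> B" for x B
  proof -
    obtain \<epsilon> where \<epsilon>: "\<epsilon> > 0" "ball (g x) \<epsilon> \<subseteq> B"
      using B open_contains_ball by blast
    obtain k where "\<forall>y\<in>cylinder x k. \<bar>g y - g x\<bar> < \<epsilon>"
      using R \<epsilon>(1) by blast
    with \<epsilon>(2) have "\<forall>y\<in>cylinder x k. g y \<in> B"
      by (auto simp: subset_iff dist_real_def abs_minus_commute)
    then show ?thesis
      using open_cylinder[of x k] by (intro exI[of _ "cylinder x k"]) (auto simp: cylinder_def)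
  qed
  then show ?L
    by (simp add: continuous_on_topological)
qed

text \<open>The codes are exactly the sequences that are eventually \<open>1\<close>. The entries of the node are the lengths
of the runs of ones between consecutive zeros; they are split off one at a time.\<close>

lemma cantor_code_surj:
  assumes "\<forall>j\<ge>k. x j"
  shows "\<exists>s. cantor_code s = x"
  using assms
proof (induction k arbitrary: x rule: less_induct)
  case (less k)
  show ?case
  proof (cases "\<forall>j. x j")
    case True
    then have "cantor_code [] = x" by auto
    then show ?thesis ..
  next
    case False
    define n where "n = (LEAST j. \<not> x j)"
    have n: "\<not> x n"
      unfolding n_def by (rule LeastI_ex) (use False in blast)
    have below: "x j" if "j < n" for j
      using not_less_Least[of j "\<lambda>j. \<not> x j"] that by (simp add: n_def)
    have "n < k"
      using less.prems n by (meson leI)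
    have "\<exists>t. cantor_code t = (\<lambda>j. x (j + Suc n))"
      using less.prems \<open>n < k\<close> by (intro less.IH[of "k - Suc n"]) auto
    then obtain t where t: "cantor_code t = (\<lambda>j. x (j + Suc n))" ..
    have "cantor_code (n # t) j = x j" for j
      using n below by (auto simp: cantor_code_Cons t not_less)
    then show ?thesis by blast
  qed
qed

text \<open>The node whose code is \<open>x\<close> up to \<open>k\<close> and constantly \<open>1\<close> afterwards; these nodes approximate \<open>x\<close>
uniformly in \<open>x\<close>.\<close>

definition truncated_node :: "(nat \<Rightarrow> bool) \<Rightarrow> nat \<Rightarrow> nat list"
  where "truncated_node x k = (SOME s. cantor_code s = (\<lambda>j. if j < k then x j else True))"

lemma cantor_code_truncated_node: "cantor_code (truncated_node x k) = (\<lambda>j. if j < k then x j else True)"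
  unfolding truncated_node_def by (rule someI_ex, rule cantor_code_surj[of k]) auto

lemma truncated_node_cong: "y \<in> cylinder x k \<Longrightarrow> truncated_node y k = truncated_node x k"
proof -
  assume "y \<in> cylinder x k"
  then have "(\<lambda>j. if j < k then y j else True) = (\<lambda>j. if j < k then x j else True)"
    by (auto simp: cylinder_def)
  then show ?thesis
    by (simp add: truncated_node_def)
qed

text \<open>The extension is the limit of \<open>f\<close> along truncations. Continuity is seen on a single truncation: points with a common initial segment have the same truncation there.\<close>

lemma code_unif_cont_extension:
  assumes "code_unif_cont UNIV f"
  obtains g where "continuous_on UNIV g" "\<And>s. g (cantor_code s) = f s"
proof -
  have Cauchy: "Cauchy (\<lambda>k. f (truncated_node x k))" for x
  proof (rule metric_CauchyI)
    fix \<epsilon> :: real assume "\<epsilon> > 0"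
    then obtain K where K: "\<And>s t. codes_agree K s t \<Longrightarrow> \<bar>f s - f t\<bar> < \<epsilon>"
      using code_unif_contD[OF assms, of \<epsilon>] by auto
    have "codes_agree K (truncated_node x m) (truncated_node x n)" if "m \<ge> K" "n \<ge> K" for m n
      using that by (auto simp: codes_agree_def cantor_code_truncated_node)
    with K show "\<exists>K. \<forall>m\<ge>K. \<forall>n\<ge>K. dist (f (truncated_node x m)) (f (truncated_node x n)) < \<epsilon>"
      unfolding dist_real_def by blast
  qed
  define g where "g x = lim (\<lambda>k. f (truncated_node x k))" for x
  have lim: "(\<lambda>k. f (truncated_node x k)) \<longlonglongrightarrow> g x" for x
    unfolding g_def using Cauchy real_Cauchy_convergent convergent_LIMSEQ_iff by blast
  have close: "\<bar>f s - g x\<bar> \<le> \<epsilon>"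
    if K: "\<And>s t. codes_agree K s t \<Longrightarrow> \<bar>f s - f t\<bar> < \<epsilon>" and s: "\<And>j. j < K \<Longrightarrow> cantor_code s j = x j"
    for s x K \<epsilon>
  proof (rule LIMSEQ_le_const2)
    show "(\<lambda>k. \<bar>f s - f (truncated_node x k)\<bar>) \<longlonglongrightarrow> \<bar>f s - g x\<bar>"
      by (intro tendsto_intros lim)
    have "codes_agree K s (truncated_node x k)" if "k \<ge> K" for k
      using that s by (auto simp: codes_agree_def cantor_code_truncated_node)
    with K show "\<exists>N. \<forall>k\<ge>N. \<bar>f s - f (truncated_node x k)\<bar> \<le> \<epsilon>"
      by (meson less_imp_le)
  qed
  show thesis
  proof
    show "continuous_on UNIV g"
      unfolding continuous_on_cantor_iff
    proof (intro allI impI)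
      fix \<epsilon> :: real assume "\<epsilon> > 0"
      then have "\<epsilon> / 3 > 0" by simp
      then obtain K where K: "\<And>s t. codes_agree K s t \<Longrightarrow> \<bar>f s - f t\<bar> < \<epsilon> / 3"
        using code_unif_contD[OF assms] by (metis UNIV_I)
      have "\<bar>g y - g x\<bar> < \<epsilon>" if y: "y \<in> cylinder x K" for x y
      proof -
        have "\<bar>f (truncated_node x K) - g x\<bar> \<le> \<epsilon> / 3"
          by (rule close[OF K]) (auto simp: cantor_code_truncated_node)
        moreover have "\<bar>f (truncated_node y K) - g y\<bar> \<le> \<epsilon> / 3"
          by (rule close[OF K]) (auto simp: cantor_code_truncated_node)
        ultimately show ?thesis
          using truncated_node_cong[OF y] \<open>\<epsilon> > 0\<close> by (simp add: abs_if split: if_splits)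
      qed
      then show "\<exists>k. \<forall>x. \<forall>y\<in>cylinder x k. \<bar>g y - g x\<bar> < \<epsilon>"
        by blast
    qed
  next
    fix s
    have "\<bar>f s - g (cantor_code s)\<bar> \<le> 0 + \<epsilon>" if \<epsilon>: "\<epsilon> > 0" for \<epsilon>
    proof -
      obtain K where "\<And>s t. codes_agree K s t \<Longrightarrow> \<bar>f s - f t\<bar> < \<epsilon>"
        using code_unif_contD[OF assms \<epsilon>] by (metis UNIV_I)
      then show ?thesis
        unfolding add_0 by (rule close) (assumption, simp)
    qed
    then have "\<bar>f s - g (cantor_code s)\<bar> \<le> 0"
      by (rule field_le_epsilon)
    then show "g (cantor_code s) = f s" by simp
  qed
qed

lemma cont_model_cantor: "cont_model 1 UNIV (UNIV :: (nat \<Rightarrow> bool) set) (\<lambda>(s, i). cantor_code s)"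
  unfolding cont_model_def
proof (intro conjI ballI allI impI)
  fix g :: "(nat \<Rightarrow> bool) \<Rightarrow> real" assume "g \<in> cont_space UNIV"
  then have g: "\<forall>\<epsilon>>0. \<exists>k. \<forall>x. \<forall>y\<in>cylinder x k. \<bar>g y - g x\<bar> < \<epsilon>"
    by (simp add: cont_space_def continuous_on_cantor_iff)
  show "copies_unif_cont 1 UNIV (\<lambda>x. g ((\<lambda>(s, i). cantor_code s) x))"
    using g by (simp add: copies_unif_cont_def code_unif_cont_def codes_agree_def cylinder_def) metis
  fix B y assume B: "\<forall>x\<in>tree_copies 1 UNIV. \<bar>g ((\<lambda>(s, i). cantor_code s) x)\<bar> \<le> B"
  have "\<bar>g y\<bar> \<le> B + \<epsilon>" if \<epsilon>: "\<epsilon> > 0" for \<epsilon>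
  proof -
    obtain k where k: "\<forall>x. \<forall>y\<in>cylinder x k. \<bar>g y - g x\<bar> < \<epsilon>"
      using g \<epsilon> by blast
    have "cantor_code (truncated_node y k) \<in> cylinder y k"
      by (simp add: cylinder_def cantor_code_truncated_node)
    then have "\<bar>g (cantor_code (truncated_node y k)) - g y\<bar> < \<epsilon>"
      using k by blast
    moreover have "\<bar>g (cantor_code (truncated_node y k))\<bar> \<le> B"
      using B by (auto simp: tree_copies_def)
    ultimately show ?thesis by linarith
  qed
  then show "\<bar>g y\<bar> \<le> B"
    by (rule field_le_epsilon)
next
  fix f :: "nat list \<times> nat \<Rightarrow> real" assume "copies_unif_cont 1 UNIV f"
  then have "code_unif_cont UNIV (\<lambda>s. f (s, 1))"
    by (simp add: copies_unif_cont_def)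
  then obtain g where "continuous_on UNIV g" "\<And>s. g (cantor_code s) = f (s, 1)"
    by (rule code_unif_cont_extension) blast
  then show "\<exists>g\<in>cont_space UNIV. \<forall>x\<in>tree_copies 1 UNIV. g ((\<lambda>(s, i). cantor_code s) x) = f x"
    by (intro bexI[of _ g]) (auto simp: tree_copies_def cont_space_def)
qed simp

section \<open>Ordinal intervals\<close>

text \<open>Every ordinal has a successor, so an ordinal is isolated from the right and only continuity from
the left is a condition.\<close>

lemma continuous_on_cord_interval_iff:
  fixes g :: "cord \<Rightarrow> real"
  shows "continuous_on {1..N} g \<longleftrightarrow>
    (\<forall>x\<in>{1..N}. \<forall>\<epsilon>>0. \<exists>y<x. \<forall>z\<in>{1..N}. y < z \<longrightarrow> z \<le> x \<longrightarrow> \<bar>g z - g x\<bar> < \<epsilon>)" (is "?L \<longleftrightarrow> ?R")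
proof
  assume L: ?L
  show ?R
  proof (intro ballI allI impI)
    fix x \<epsilon> assume x: "x \<in> {1..N}" and "(\<epsilon>::real) > 0"
    then obtain A where A: "open A" "x \<in> A" "\<forall>z\<in>{1..N}. z \<in> A \<longrightarrow> g z \<in> ball (g x) \<epsilon>"
      using L unfolding continuous_on_topological by (metis centre_in_ball open_ball)
    have "0 < x"
      using x by (simp add: cord_one_le_iff)
    with A obtain y where y: "y < x" "{y<..x} \<subseteq> A"
      using open_left by blast
    have "\<bar>g z - g x\<bar> < \<epsilon>" if "z \<in> {1..N}" "y < z" "z \<le> x" for z
      using A(3) y(2) that by (auto simp: subset_iff dist_real_def abs_minus_commute)
    with y(1) show "\<exists>y<x. \<forall>z\<in>{1..N}. y < z \<longrightarrow> z \<le> x \<longrightarrow> \<bar>g z - g x\<bar> < \<epsilon>"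
      by blast
  qed
next
  assume R: ?R
  have "\<exists>A. open A \<and> x \<in> A \<and> (\<forall>z\<in>{1..N}. z \<in> A \<longrightarrow> g z \<in> B)"
    if x: "x \<in> {1..N}" and B: "open B" "g x \<in> B" for x B
  proof -
    obtain \<epsilon> where \<epsilon>: "\<epsilon> > 0" "ball (g x) \<epsilon> \<subseteq> B"
      using B open_contains_ball by blast
    then obtain y where y: "y < x" "\<forall>z\<in>{1..N}. y < z \<longrightarrow> z \<le> x \<longrightarrow> \<bar>g z - g x\<bar> < \<epsilon>"
      using R x by blast
    have "\<forall>z\<in>{1..N}. z \<in> {y<..<cord_succ x} \<longrightarrow> g z \<in> B"
      using y(2) \<epsilon>(2) by (auto simp: cord_less_succ_iff subset_iff dist_real_def abs_minus_commute)
    then show ?thesis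
      using y(1) cord_less_succ[of x] by (intro exI[of _ "{y<..<cord_succ x}"]) auto
  qed
  then show ?L
    unfolding continuous_on_topological by blast
qed

text \<open>The recursion for the rank in terms of strict lower bounds. At a leaf both sides are false, which
is the clause \<open>0\<close> of the recursion.\<close>

lemma less_node_rank_iff:
  assumes "no_infinite_branch \<Lambda>" "s \<in> \<Lambda>"
  shows "z < node_rank \<Lambda> s \<longleftrightarrow> (\<exists>t\<in>\<Lambda>. strict_prefix s t \<and> z \<le> node_rank \<Lambda> t)"
proof (cases "s \<in> leaves \<Lambda>")
  case True
  then show ?thesis
    using node_rank_unfold[OF assms] leD[OF cord_zero_le] by (auto simp: leaves_def)
next
  case False
  have "countable {node_rank \<Lambda> t + 1 | t. t \<in> \<Lambda> \<and> strict_prefix s t}"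
    by (rule countable_subset[of _ "range (\<lambda>t. node_rank \<Lambda> t + 1)"]) auto
  with False show ?thesis
    unfolding node_rank_unfold[OF assms]
    by (auto simp: cord_less_Sup_iff cord_add_one cord_less_succ_iff)
qed

text \<open>The nodes above \<open>s\<close> are placed in the ordinals \<open>x\<close> with \<open>block_start \<Lambda> b s < x \<le> block_end \<Lambda> b s\<close>, a
block of length \<open>\<omega>\<close> to the power of the rank of \<open>s\<close>, and \<open>s\<close> itself is placed at its end. The
blocks of the children of \<open>s\<close> are laid out consecutively from the start of the block of \<open>s\<close>. The
start of a block is given by recursion along the path from the root, hence on the reversed list;
\<open>b\<close> is the start of the whole tree.\<close>

primrec rev_block_start :: "nat list set \<Rightarrow> cord \<Rightarrow> nat list \<Rightarrow> cord"
  where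
    "rev_block_start \<Lambda> b [] = b"
  | "rev_block_start \<Lambda> b (n # r) =
      rev_block_start \<Lambda> b r + omega_power_sum (\<lambda>k. node_rank \<Lambda> (rev r @ [k])) n"

definition block_start :: "nat list set \<Rightarrow> cord \<Rightarrow> nat list \<Rightarrow> cord"
  where "block_start \<Lambda> b s = rev_block_start \<Lambda> b (rev s)"

definition block_end :: "nat list set \<Rightarrow> cord \<Rightarrow> nat list \<Rightarrow> cord"
  where "block_end \<Lambda> b s = block_start \<Lambda> b s + omega_power (node_rank \<Lambda> s)"

lemma block_start_Nil [simp]: "block_start \<Lambda> b [] = b"
  by (simp add: block_start_def)

lemma block_start_snoc:
  "block_start \<Lambda> b (s @ [n]) = block_start \<Lambda> b s + omega_power_sum (\<lambda>k. node_rank \<Lambda> (s @ [k])) n"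
  by (simp add: block_start_def)

lemma block_start_first_child: "block_start \<Lambda> b (s @ [0]) = block_start \<Lambda> b s"
  by (simp add: block_start_snoc cord_add_zero)

lemma block_end_child: "block_end \<Lambda> b (s @ [n]) = block_start \<Lambda> b (s @ [Suc n])"
  by (simp add: block_end_def block_start_snoc cord_add_assoc)

lemma block_start_less_end: "block_start \<Lambda> b s < block_end \<Lambda> b s"
  by (simp add: block_end_def cord_less_add_omega_power)

lemma block_start_child_mono: "n \<le> k \<Longrightarrow> block_start \<Lambda> b (s @ [n]) \<le> block_start \<Lambda> b (s @ [k])"
  by (rule lift_Suc_mono_le)
    (metis block_end_child block_start_less_end less_imp_le)

text \<open>The properties of trees of countable rank on which the placement in the ordinals rests.
Monotonicity is what constant and strictly increasing ranks of the children have in common.\<close>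

locale ranked_tree =
  fixes \<Lambda> :: "nat list set"
  assumes hered: "hereditary \<Lambda>"
    and root: "[] \<in> \<Lambda>"
    and wf: "no_infinite_branch \<Lambda>"
    and children: "s \<in> non_leaves \<Lambda> \<Longrightarrow> s @ [n] \<in> \<Lambda>"
    and mono_ranks: "s \<in> non_leaves \<Lambda> \<Longrightarrow> mono (\<lambda>n. node_rank \<Lambda> (s @ [n]))"
begin

lemma non_leafI: "s \<in> \<Lambda> \<Longrightarrow> s @ [n] \<in> \<Lambda> \<Longrightarrow> s \<in> non_leaves \<Lambda>"
  using prefix_snocD[of s n "s @ [n]"] by (auto simp: non_leaves_def leaves_def)

lemma non_leaf_in: "s \<in> non_leaves \<Lambda> \<Longrightarrow> s \<in> \<Lambda>"
  by (simp add: non_leaves_def)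

lemma node_rank_less: "s \<in> \<Lambda> \<Longrightarrow> t \<in> \<Lambda> \<Longrightarrow> strict_prefix s t \<Longrightarrow> node_rank \<Lambda> t < node_rank \<Lambda> s"
  using less_node_rank_iff[OF wf] by blast

lemma less_node_rank_child:
  assumes "s \<in> non_leaves \<Lambda>" "z < node_rank \<Lambda> s"
  shows "\<exists>n. z \<le> node_rank \<Lambda> (s @ [n])"
proof -
  obtain t where t: "t \<in> \<Lambda>" "strict_prefix s t" "z \<le> node_rank \<Lambda> t"
    using assms less_node_rank_iff[OF wf non_leaf_in] by blast
  then obtain n u where u: "t = (s @ [n]) @ u"
    by (auto elim: strict_prefixE')
  have "node_rank \<Lambda> t \<le> node_rank \<Lambda> (s @ [n])"
  proof (cases "u = []")
    case False
    then have "strict_prefix (s @ [n]) t"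
      by (auto simp: u strict_prefix_def)
    then show ?thesis
      using node_rank_less[OF children[OF assms(1)] t(1)] by (simp add: less_imp_le)
  qed (simp add: u)
  with t(3) show ?thesis
    using order_trans by blast
qed

lemma block_start_child_less:
  assumes "s \<in> non_leaves \<Lambda>"
  shows "block_start \<Lambda> b (s @ [n]) < block_end \<Lambda> b s"
proof -
  have "omega_power_sum (\<lambda>k. node_rank \<Lambda> (s @ [k])) n < omega_power (node_rank \<Lambda> s)"
    using assms mono_ranks node_rank_less[OF non_leaf_in children, of s s]
    by (intro omega_power_sum_less) (auto simp: strict_prefix_def)
  then show ?thesis
    by (simp add: block_start_snoc block_end_def cord_add_strict_mono)
qed

text \<open>The blocks of the children exhaust the block of \<open>s\<close> up to its end point. Together with
\<open>block_start_child_less\<close> this says that the intervals from the block of the \<open>n\<close>-th child to the end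
of the block of \<open>s\<close> form a neighbourhood base on the left of the position of \<open>s\<close>.\<close>

lemma block_start_child_cofinal:
  assumes "s \<in> non_leaves \<Lambda>" "y < block_end \<Lambda> b s"
  shows "\<exists>n. y < block_start \<Lambda> b (s @ [n])"
proof (cases "y < block_start \<Lambda> b s")
  case True
  then show ?thesis
    using block_start_first_child by metis
next
  case False
  then obtain z where z: "z < omega_power (node_rank \<Lambda> s)" "y \<le> block_start \<Lambda> b s + z"
    using assms(2) by (auto simp: block_end_def cord_less_add_iff)
  obtain n where "z < omega_power_sum (\<lambda>k. node_rank \<Lambda> (s @ [k])) n"
    using omega_power_sum_cofinal[OF mono_ranks[OF assms(1)] less_node_rank_child[OF assms(1)] z(1)]
    by blast
  then have "y < block_start \<Lambda> b (s @ [n])"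
    using order_le_less_trans[OF z(2) cord_add_strict_mono] by (simp add: block_start_snoc)
  then show ?thesis ..
qed

lemma block_nested:
  assumes "s @ u \<in> \<Lambda>"
  shows "block_start \<Lambda> b s \<le> block_start \<Lambda> b (s @ u) \<and> block_end \<Lambda> b (s @ u) \<le> block_end \<Lambda> b s"
  using assms
proof (induction u rule: rev_induct)
  case (snoc n u)
  then have su: "s @ u \<in> \<Lambda>"
    using hereditaryD[OF hered, of "s @ u" "[n]"] by simp
  then have nl: "s @ u \<in> non_leaves \<Lambda>"
    using non_leafI[of "s @ u" n] snoc.prems by simp
  have "block_start \<Lambda> b (s @ u) \<le> block_start \<Lambda> b ((s @ u) @ [n])"
    using block_start_child_mono[of 0 n \<Lambda> b "s @ u"] unfolding block_start_first_child by simp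
  moreover have "block_end \<Lambda> b ((s @ u) @ [n]) \<le> block_end \<Lambda> b (s @ u)"
    using block_start_child_less[OF nl] by (simp only: block_end_child less_imp_le)
  ultimately show ?case
    using snoc.IH[OF su] by (auto simp del: append_assoc simp: append_assoc[symmetric] intro: order_trans)
qed simp

lemma block_end_child_less:
  assumes "s @ n # u \<in> \<Lambda>"
  shows "block_end \<Lambda> b (s @ n # u) < block_end \<Lambda> b s"
proof -
  have "s @ [n] \<in> \<Lambda>"
    using hereditaryD[OF hered, of "s @ [n]" u] assms by simp
  then have "s \<in> non_leaves \<Lambda>"
    using non_leafI hereditaryD[OF hered] by blast
  then have "block_end \<Lambda> b (s @ [n]) < block_end \<Lambda> b s"
    using block_start_child_less by (simp add: block_end_child)
  moreover have "block_end \<Lambda> b (s @ n # u) \<le> block_end \<Lambda> b (s @ [n])"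
    using block_nested[of "s @ [n]" u] assms by simp
  ultimately show ?thesis by simp
qed

text \<open>Extensions come before the node that they extend, and incomparable nodes are ordered by the first
entry at which they differ.\<close>

lemma inj_on_block_end: "inj_on (block_end \<Lambda> b) \<Lambda>"
proof -
  have less: "block_end \<Lambda> b (c @ n # u) < block_end \<Lambda> b (c @ k # v)"
    if "c @ n # u \<in> \<Lambda>" "c @ k # v \<in> \<Lambda>" "n < k" for c n u k v
  proof -
    have "block_end \<Lambda> b (c @ n # u) \<le> block_end \<Lambda> b (c @ [n])"
      using block_nested[of "c @ [n]" u] that by simp
    also have "\<dots> \<le> block_start \<Lambda> b (c @ [k])"
      unfolding block_end_child using that by (intro block_start_child_mono) simp
    also have "\<dots> \<le> block_start \<Lambda> b (c @ k # v)"
      using block_nested[of "c @ [k]" v] that by simp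
    also have "\<dots> < block_end \<Lambda> b (c @ k # v)"
      by (rule block_start_less_end)
    finally show ?thesis .
  qed
  show ?thesis
  proof (rule inj_onI, rule ccontr)
    fix s t assume st: "s \<in> \<Lambda>" "t \<in> \<Lambda>" "block_end \<Lambda> b s = block_end \<Lambda> b t" "s \<noteq> t"
    consider "strict_prefix s t" | "strict_prefix t s" | "s \<parallel> t"
      using st(4) by (auto simp: strict_prefix_def parallel_def)
    then show False
    proof cases
      case 1
      then obtain n u where "t = s @ n # u"
        by (auto elim: strict_prefixE')
      with block_end_child_less[of s n u b] st show False by simp
    next
      case 2
      then obtain n u where "s = t @ n # u"
        by (auto elim: strict_prefixE')
      with block_end_child_less[of t n u b] st show False by simp
    next
      case 3
      then obtain c n u k v where "n \<noteq> k" "s = c @ n # u" "t = c @ k # v"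
        using parallel_decomp by blast
      with less[of c n u k v] less[of c k v n u] st show False
        by (cases n k rule: linorder_cases) auto
    qed
  qed
qed

text \<open>A leaf has a block of length \<open>\<omega>\<^sup>0 = 1\<close>. In any other block, a point before the end lies in the block
of the predecessor of the first child whose block starts at or after it.\<close>

lemma block_cases:
  assumes "s \<in> \<Lambda>" "block_start \<Lambda> b s < z" "z \<le> block_end \<Lambda> b s"
  obtains "z = block_end \<Lambda> b s"
  | n where "s \<in> non_leaves \<Lambda>" "block_start \<Lambda> b (s @ [n]) < z" "z \<le> block_end \<Lambda> b (s @ [n])"
proof (cases "s \<in> leaves \<Lambda>")
  case True
  then have "block_end \<Lambda> b s = cord_succ (block_start \<Lambda> b s)"
    using node_rank_unfold[OF wf assms(1)] by (simp add: block_end_def omega_power_zero cord_add_one)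
  with assms(2,3) have "z = block_end \<Lambda> b s"
    by (simp add: cord_succ_le_iff antisym)
  then show thesis by (rule that)
next
  case False
  then have nl: "s \<in> non_leaves \<Lambda>"
    using assms(1) by (simp add: non_leaves_def)
  show thesis
  proof (cases "z = block_end \<Lambda> b s")
    case False
    then have "z < block_end \<Lambda> b s"
      using assms(3) by simp
    then have ex: "\<exists>n. z \<le> block_start \<Lambda> b (s @ [n])"
      using block_start_child_cofinal[OF nl] less_imp_le by blast
    define n where "n = (LEAST n. z \<le> block_start \<Lambda> b (s @ [n]))"
    have n: "z \<le> block_start \<Lambda> b (s @ [n])"
      unfolding n_def using ex by (rule LeastI_ex)
    have "n \<noteq> 0"
    proof
      assume "n = 0"
      with n have "z \<le> block_start \<Lambda> b s"
        by (simp only: block_start_first_child)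
      with assms(2) show False by simp
    qed
    then obtain k where k: "n = Suc k"
      using not0_implies_Suc by blast
    then have "\<not> z \<le> block_start \<Lambda> b (s @ [k])"
      unfolding n_def by (metis lessI not_less_Least)
    with n k nl show thesis
      by (intro that(2)[of k]) (simp_all add: block_end_child)
  qed (rule that)
qed

text \<open>Descend into the blocks of children until the point is the end of a block; this stops because there
is no infinite branch.\<close>

lemma block_end_surj:
  assumes "s \<in> \<Lambda>" "block_start \<Lambda> b s < z" "z \<le> block_end \<Lambda> b s"
  shows "\<exists>t\<in>\<Lambda>. prefix s t \<and> block_end \<Lambda> b t = z"
  using wf assms
proof (induction s rule: well_founded_tree_induct)
  case (1 s)
  from 1(1,3,4) show ?case
  proof (cases rule: block_cases)
    case 1
    with \<open>s \<in> \<Lambda>\<close> show ?thesis by blast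
  next
    case (2 n)
    have "\<exists>t\<in>\<Lambda>. prefix (s @ [n]) t \<and> block_end \<Lambda> b t = z"
      using 2 children by (intro 1(2)) (auto simp: strict_prefix_def)
    then show ?thesis
      by (meson append_prefixD)
  qed
qed

lemma node_cont_block_end:
  assumes "continuous_on {1..N} g" "\<And>t. t \<in> \<Lambda> \<Longrightarrow> block_end \<Lambda> b t \<in> {1..N}" "s \<in> \<Lambda>"
  shows "node_cont \<Lambda> (\<lambda>t. g (block_end \<Lambda> b t)) s"
proof (cases "s \<in> non_leaves \<Lambda>")
  case True
  show ?thesis
    unfolding node_cont_def
  proof (intro allI impI)
    fix \<epsilon> :: real assume "\<epsilon> > 0"
    then obtain y where y: "y < block_end \<Lambda> b s"
      "\<And>z. z \<in> {1..N} \<Longrightarrow> y < z \<Longrightarrow> z \<le> block_end \<Lambda> b s \<Longrightarrow> \<bar>g z - g (block_end \<Lambda> b s)\<bar> < \<epsilon>"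
      using assms unfolding continuous_on_cord_interval_iff by blast
    obtain M where M: "y < block_start \<Lambda> b (s @ [M])"
      using block_start_child_cofinal[OF True y(1)] by blast
    have "\<bar>g (block_end \<Lambda> b t) - g (block_end \<Lambda> b s)\<bar> < \<epsilon>"
      if t: "n \<ge> M" "t \<in> \<Lambda>" "prefix (s @ [n]) t" for n t
    proof (rule y(2))
      obtain u where u: "t = (s @ [n]) @ u"
        using t(3) by (auto simp: prefix_def)
      have "y < block_start \<Lambda> b (s @ [n])"
        using M block_start_child_mono[OF t(1)] by (rule order_less_le_trans)
      also have "\<dots> \<le> block_start \<Lambda> b t"
        using block_nested[of "s @ [n]" u b] t(2) u by simp
      also have "\<dots> < block_end \<Lambda> b t"
        by (rule block_start_less_end)
      finally show "y < block_end \<Lambda> b t" .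
      show "block_end \<Lambda> b t \<le> block_end \<Lambda> b s"
        using block_end_child_less[of s n u b] t(2) u by simp
    qed (rule assms(2)[OF t(2)])
    then show "\<exists>N. \<forall>n\<ge>N. \<forall>t\<in>\<Lambda>. prefix (s @ [n]) t \<longrightarrow>
        \<bar>g (block_end \<Lambda> b t) - g (block_end \<Lambda> b s)\<bar> < \<epsilon>"
      by blast
  qed
next
  case False
  then have "\<not> prefix (s @ [n]) t" if "t \<in> \<Lambda>" for n t
    using assms(3) that by (auto simp: non_leaves_def leaves_def dest: prefix_snocD)
  then show ?thesis
    by (auto simp: node_cont_def)
qed

text \<open>The converse direction to \<open>node_cont_block_end\<close>: by surjectivity every point to the left of the
position of \<open>s\<close> and close to it is the position of a node above a late child of \<open>s\<close>. The bound
\<open>block_start \<Lambda> b s \<le> y\<close> keeps these points within the same copy of the tree.\<close>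

lemma left_cont_at_block_end:
  assumes "node_cont \<Lambda> f s" "s \<in> \<Lambda>" "\<epsilon> > 0"
  shows "\<exists>y. block_start \<Lambda> b s \<le> y \<and> y < block_end \<Lambda> b s \<and>
    (\<forall>t\<in>\<Lambda>. y < block_end \<Lambda> b t \<longrightarrow> block_end \<Lambda> b t \<le> block_end \<Lambda> b s \<longrightarrow> \<bar>f t - f s\<bar> < \<epsilon>)"
proof -
  obtain M where M: "\<And>n t. n \<ge> M \<Longrightarrow> t \<in> \<Lambda> \<Longrightarrow> prefix (s @ [n]) t \<Longrightarrow> \<bar>f t - f s\<bar> < \<epsilon>"
    using assms(1,3) unfolding node_cont_def by blast
  \<comment> \<open>a leaf is placed at a successor ordinal, the successor of the start of its block\<close>
  define y where "y = (if s \<in> leaves \<Lambda> then block_start \<Lambda> b s else block_start \<Lambda> b (s @ [M]))"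
  have nl: "s \<in> non_leaves \<Lambda>" if "s \<notin> leaves \<Lambda>"
    using assms(2) that by (simp add: non_leaves_def)
  have y1: "block_start \<Lambda> b s \<le> y"
    using block_start_child_mono[of 0 M \<Lambda> b s] by (simp add: y_def block_start_first_child)
  have y2: "y < block_end \<Lambda> b s"
    using block_start_less_end block_start_child_less nl by (simp add: y_def)
  have "\<bar>f t - f s\<bar> < \<epsilon>" if t: "t \<in> \<Lambda>" "y < block_end \<Lambda> b t" "block_end \<Lambda> b t \<le> block_end \<Lambda> b s" for t
  proof -
    have "block_start \<Lambda> b s < block_end \<Lambda> b t"
      using y1 t(2) by (rule order_le_less_trans)
    then consider "block_end \<Lambda> b t = block_end \<Lambda> b s"
      | n where "s \<in> non_leaves \<Lambda>" "block_start \<Lambda> b (s @ [n]) < block_end \<Lambda> b t"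
          "block_end \<Lambda> b t \<le> block_end \<Lambda> b (s @ [n])"
      using block_cases[OF assms(2) _ t(3)] by blast
    then show ?thesis
    proof cases
      case 1
      then have "t = s"
        using t(1) assms(2) by (rule inj_onD[OF inj_on_block_end])
      with assms(3) show ?thesis by simp
    next
      case (2 n)
      then obtain t' where t': "t' \<in> \<Lambda>" "prefix (s @ [n]) t'" "block_end \<Lambda> b t' = block_end \<Lambda> b t"
        using block_end_surj[OF children[OF 2(1)] 2(2,3)] by blast
      have "t' = t"
        using t'(3) by (rule inj_onD[OF inj_on_block_end]) (use t'(1) t(1) in auto)
      have "n \<ge> M"
      proof (rule ccontr)
        assume "\<not> n \<ge> M"
        then have "block_end \<Lambda> b (s @ [n]) \<le> block_start \<Lambda> b (s @ [M])"
          unfolding block_end_child by (intro block_start_child_mono) simp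
        with 2 t(2) show False
          by (auto simp: y_def non_leaves_def)
      qed
      with M t' \<open>t' = t\<close> show ?thesis by blast
    qed
  qed
  with y1 y2 show ?thesis by blast
qed

end

lemma ranked_tree_of_rank:
  assumes "tree_of_rank (Ord \<beta>) \<Lambda>"
  shows "ranked_tree \<Lambda>"
proof
  fix s assume s: "s \<in> non_leaves \<Lambda>"
  then show "s @ [n] \<in> \<Lambda>" for n
    using assms by (auto simp: non_leaves_def)
  have "(\<exists>\<gamma>. \<forall>n. node_rank \<Lambda> (s @ [n]) = \<gamma>) \<or> strict_mono (\<lambda>n. node_rank \<Lambda> (s @ [n]))"
    using assms s by simp
  then show "mono (\<lambda>n. node_rank \<Lambda> (s @ [n]))"
    by (auto dest: strict_mono_mono intro: monoI)
qed (use assms in auto)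

lemma tree_of_rank_root:
  assumes "tree_of_rank (Ord (\<alpha> + 1)) \<Lambda>"
  shows "node_rank \<Lambda> [] = \<alpha>"
proof -
  have "cord_succ \<alpha> = cord_succ (node_rank \<Lambda> [])"
    using assms by (simp add: cord_add_one)
  then show ?thesis
    by (metis antisym cord_less_succ cord_less_succ_iff)
qed

text \<open>The \<open>i\<close>-th copy of the tree occupies the interval from \<open>\<omega>\<^sup>\<alpha> \<cdot> (i - 1)\<close> (excluded) to \<open>\<omega>\<^sup>\<alpha> \<cdot> i\<close>
(included). Copies are numbered from \<open>1\<close>, and the point \<open>0\<close> is left out.\<close>

lemma cont_model_ordinal:
  assumes "tree_of_rank (Ord (\<alpha> + 1)) \<Lambda>"
  shows "\<exists>\<phi>. cont_model m \<Lambda> {1..omega_power \<alpha> * cord_of_nat m} \<phi>"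
proof -
  interpret ranked_tree \<Lambda>
    using assms by (rule ranked_tree_of_rank)
  note rank = tree_of_rank_root[OF assms]
  define c where "c i = omega_power \<alpha> * cord_of_nat i" for i
  define \<phi> where "\<phi> = (\<lambda>(s, i). block_end \<Lambda> (c (i - 1)) s)"
  have c_Suc: "c (Suc i) = block_end \<Lambda> (c i) []" for i
    by (simp add: c_def cord_times_succ block_end_def rank)
  have c_mono: "i \<le> j \<Longrightarrow> c i \<le> c j" for i j
    by (rule lift_Suc_mono_le) (simp add: c_def cord_times_succ cord_le_add)
  have c0: "c 0 = 0"
    by (simp add: c_def cord_times_zero)
  have range: "c (i - 1) < \<phi> (s, i) \<and> \<phi> (s, i) \<le> c i" if s: "s \<in> \<Lambda>" "i \<ge> 1" for s i
  proof -
    obtain j where j: "i = Suc j"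
      using s(2) by (cases i) auto
    then show ?thesis
      using block_nested[of "[]" s "c j"] s(1) block_start_less_end[of \<Lambda> "c j" s]
      by (auto simp: \<phi>_def c_Suc intro: order_le_less_trans)
  qed
  have in_K: "\<phi> x \<in> {1..c m}" if mem: "x \<in> tree_copies m \<Lambda>" for x
  proof -
    obtain s i where x: "x = (s, i)" "s \<in> \<Lambda>" "1 \<le> i" "i \<le> m"
      using mem by (auto simp: tree_copies_def)
    have "0 < \<phi> x" "\<phi> x \<le> c m"
      using range[OF x(2,3)] c_mono[OF x(4)] cord_zero_le[of "c (i - 1)"] by (auto simp: x(1))
    then show ?thesis
      by (simp add: cord_one_le_iff)
  qed
  have surj: "\<exists>s\<in>\<Lambda>. \<phi> (s, i) = z" if z: "c (i - 1) < z" "z \<le> c i" "i \<ge> 1" for i z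
  proof -
    obtain j where j: "i = Suc j"
      using z(3) by (cases i) auto
    then show ?thesis
      using block_end_surj[OF root, of "c j" z] z by (auto simp: \<phi>_def c_Suc)
  qed
  have surj_K: "\<exists>i\<in>{1..m}. c (i - 1) < z \<and> z \<le> c i" if z: "z \<in> {1..c m}" for z
  proof -
    define i where "i = (LEAST i. z \<le> c i)"
    have i: "z \<le> c i" "i \<le> m"
      unfolding i_def using z by (auto intro: LeastI[of "\<lambda>i. z \<le> c i" m] Least_le)
    have "\<not> z \<le> c 0"
      using z by (auto simp: c0 cord_one_le_iff)
    with i have "i \<ge> 1"
      by (cases i) auto
    then have "\<not> z \<le> c (i - 1)"
      using not_less_Least[of "i - 1" "\<lambda>i. z \<le> c i"] by (simp add: i_def[symmetric])
    with i \<open>i \<ge> 1\<close> show ?thesis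
      by (auto simp: not_le)
  qed
  have same_copy: "i = j" if "c (i - 1) < z" "z \<le> c i" "c (j - 1) < z" "z \<le> c j" for i j z
  proof (rule ccontr)
    assume "i \<noteq> j"
    then have "i \<le> j - 1 \<or> j \<le> i - 1" by linarith
    then have "c i \<le> c (j - 1) \<or> c j \<le> c (i - 1)"
      using c_mono by blast
    with that show False by auto
  qed
  have inj: "inj_on \<phi> (tree_copies m \<Lambda>)"
  proof (rule inj_onI)
    fix x y assume xy: "x \<in> tree_copies m \<Lambda>" "y \<in> tree_copies m \<Lambda>" "\<phi> x = \<phi> y"
    obtain s i t j where st: "x = (s, i)" "y = (t, j)" "s \<in> \<Lambda>" "t \<in> \<Lambda>" "i \<ge> 1" "j \<ge> 1"
      using xy(1,2) by (auto simp: tree_copies_def)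
    have "i = j"
      using range[OF st(3,5)] range[OF st(4,6)] xy(3) same_copy[of i "\<phi> x" j] by (simp add: st(1,2))
    then show "x = y"
      using xy(3) st inj_onD[OF inj_on_block_end] by (auto simp: \<phi>_def)
  qed
  have "cont_model m \<Lambda> {1..c m} \<phi>"
    unfolding cont_model_def
  proof (intro conjI ballI allI impI)
    show "\<phi> ` tree_copies m \<Lambda> \<subseteq> {1..c m}"
      using in_K by blast
  next
    fix g assume g: "g \<in> cont_space {1..c m}"
    show "copies_unif_cont m \<Lambda> (\<lambda>x. g (\<phi> x))"
      unfolding copies_unif_cont_def
    proof
      fix i assume i: "i \<in> {1..m}"
      have "node_cont \<Lambda> (\<lambda>s. g (block_end \<Lambda> (c (i - 1)) s)) s" if "s \<in> \<Lambda>" for s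
        using g in_K[of "(_, i)"] i that
        by (intro node_cont_block_end[of "c m"]) (auto simp: cont_space_def \<phi>_def tree_copies_def)
      then show "code_unif_cont \<Lambda> (\<lambda>s. g (\<phi> (s, i)))"
        unfolding \<phi>_def by (intro node_cont_code_unif_cont_well_founded[OF hered wf]) simp
    qed
    fix B z assume B: "\<forall>x\<in>tree_copies m \<Lambda>. \<bar>g (\<phi> x)\<bar> \<le> B" and z: "z \<in> {1..c m}"
    obtain i where i: "i \<in> {1..m}" "c (i - 1) < z" "z \<le> c i"
      using surj_K[OF z] by blast
    then obtain s where "s \<in> \<Lambda>" "\<phi> (s, i) = z"
      using surj[of i z] by auto
    with B i show "\<bar>g z\<bar> \<le> B"
      by (auto simp: tree_copies_def)
  next
    fix f assume f: "copies_unif_cont m \<Lambda> f"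
    define g where "g z = (if z \<in> {1..c m} then f (inv_into (tree_copies m \<Lambda>) \<phi> z) else 0)" for z
    have g: "g (\<phi> x) = f x" if "x \<in> tree_copies m \<Lambda>" for x
      using in_K[OF that] inv_into_f_f[OF inj that] by (simp add: g_def)
    have "continuous_on {1..c m} g"
      unfolding continuous_on_cord_interval_iff
    proof (intro ballI allI impI)
      fix z and \<epsilon> :: real assume z: "z \<in> {1..c m}" and "\<epsilon> > 0"
      obtain i where i: "i \<in> {1..m}" "c (i - 1) < z" "z \<le> c i"
        using surj_K[OF z] by blast
      then obtain s where s: "s \<in> \<Lambda>" "\<phi> (s, i) = z"
        using surj[of i z] by auto
      have "node_cont \<Lambda> (\<lambda>t. f (t, i)) s"
        using f i(1) s(1) by (intro code_unif_cont_node_cont) (auto simp: copies_unif_cont_def)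
      from left_cont_at_block_end[OF this s(1) \<open>\<epsilon> > 0\<close>, of "c (i - 1)"]
      obtain y where y: "block_start \<Lambda> (c (i - 1)) s \<le> y" "y < z"
        "\<And>t. t \<in> \<Lambda> \<Longrightarrow> y < \<phi> (t, i) \<Longrightarrow> \<phi> (t, i) \<le> z \<Longrightarrow> \<bar>f (t, i) - f (s, i)\<bar> < \<epsilon>"
        using s(2) by (auto simp: \<phi>_def)
      have cy: "c (i - 1) \<le> y"
        using order_trans[OF _ y(1)] block_nested[of "[]" s "c (i - 1)"] s(1) by simp
      have "\<bar>g w - g z\<bar> < \<epsilon>" if w: "y < w" "w \<le> z" for w
      proof -
        obtain t where t: "t \<in> \<Lambda>" "\<phi> (t, i) = w"
          using surj[of i w] i(1) order_le_less_trans[OF cy w(1)] order_trans[OF w(2) i(3)] by auto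
        have "g w = f (t, i)" "g z = f (s, i)"
          using g[of "(t, i)"] g[of "(s, i)"] s t i(1) by (auto simp: tree_copies_def)
        with y(3)[OF t(1)] t(2) w show ?thesis by simp
      qed
      with y(2) show "\<exists>y<z. \<forall>w\<in>{1..c m}. y < w \<longrightarrow> w \<le> z \<longrightarrow> \<bar>g w - g z\<bar> < \<epsilon>"
        by blast
    qed
    then have "g \<in> cont_space {1..c m}"
      by (simp add: cont_space_def g_def)
    with g show "\<exists>g\<in>cont_space {1..c m}. \<forall>x\<in>tree_copies m \<Lambda>. g (\<phi> x) = f x"
      by blast
  qed
  then show ?thesis
    unfolding c_def by blast
qed

section \<open>Trees of every rank\<close>

text \<open>For a successor the sequence is constant with value the predecessor. A limit is the supremum of a
strictly increasing sequence because only countably many ordinals lie below it: each term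
exceeds the previous one and the next entry of an enumeration.\<close>

lemma cofinal_sequence:
  fixes \<alpha> :: cord
  assumes "0 < \<alpha>"
  obtains g :: "nat \<Rightarrow> cord"
  where "(\<exists>\<gamma>. \<forall>n. g n = \<gamma>) \<or> strict_mono g" "\<And>z. z < \<alpha> \<longleftrightarrow> (\<exists>n. z \<le> g n)"
proof (cases "\<exists>\<gamma><\<alpha>. \<forall>z<\<alpha>. z \<le> \<gamma>")
  case True
  then obtain \<gamma> where "\<gamma> < \<alpha>" "\<forall>z<\<alpha>. z \<le> \<gamma>" by blast
  then show thesis
    by (intro that[of "\<lambda>_. \<gamma>"]) auto
next
  case False
  define E where "E = from_nat_into {..<\<alpha>}"
  have E: "range E = {..<\<alpha>}"
    unfolding E_def using assms by (intro range_from_nat_into countable_lessThan_cord) auto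
  have next_elem: "\<exists>z<\<alpha>. x < z" if "x < \<alpha>" for x
    using False that by (meson not_le)
  have "\<exists>g. \<forall>n. g n < \<alpha> \<and> (g n < g (Suc n) \<and> E n < g (Suc n))"
  proof (rule dependent_nat_choice)
    show "\<exists>x. x < \<alpha>"
      using assms by blast
    fix x and n assume "x < \<alpha>"
    then have "max x (E n) < \<alpha>"
      using E by auto
    then show "\<exists>y<\<alpha>. x < y \<and> E n < y"
      using next_elem by fastforce
  qed
  then obtain g where g: "\<And>n. g n < \<alpha>" "\<And>n. g n < g (Suc n)" "\<And>n. E n < g (Suc n)"
    by blast
  have "z < \<alpha> \<longleftrightarrow> (\<exists>n. z \<le> g n)" for z
  proof
    assume "z < \<alpha>"
    then obtain n where "z = E n"
      using E by blast
    then show "\<exists>n. z \<le> g n"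
      using g(3)[of n] less_imp_le by blast
  next
    assume "\<exists>n. z \<le> g n"
    then show "z < \<alpha>"
      using g(1) order_le_less_trans by blast
  qed
  moreover have "strict_mono g"
    using g(2) by (simp add: strict_mono_Suc_iff)
  ultimately show thesis
    using that by blast
qed

definition joined_tree :: "(nat \<Rightarrow> nat list set) \<Rightarrow> nat list set"
  where "joined_tree L = insert [] {n # t | n t. t \<in> L n}"

lemma Nil_in_joined_tree [simp]: "[] \<in> joined_tree L"
  by (simp add: joined_tree_def)

lemma Cons_in_joined_tree [simp]: "n # t \<in> joined_tree L \<longleftrightarrow> t \<in> L n"
  by (simp add: joined_tree_def)

lemma extension_in_joined_tree:
  "(\<exists>u\<in>joined_tree L. strict_prefix (n # t) u \<and> Q u) \<longleftrightarrow> (\<exists>u\<in>L n. strict_prefix t u \<and> Q (n # u))"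
  (is "?L \<longleftrightarrow> ?R")
proof
  assume ?L
  then obtain u where u: "u \<in> joined_tree L" "strict_prefix (n # t) u" "Q u" by blast
  then obtain v where "u = n # v"
    by (cases u) (auto simp: strict_prefix_def)
  with u show ?R by auto
next
  assume ?R
  then obtain u where "u \<in> L n" "strict_prefix t u" "Q (n # u)" by blast
  then show ?L
    by (intro bexI[of _ "n # u"]) auto
qed

lemma root_extension_in_joined_tree:
  "(\<exists>u\<in>joined_tree L. strict_prefix [] u \<and> Q u) \<longleftrightarrow> (\<exists>n. \<exists>t\<in>L n. Q (n # t))" (is "?L \<longleftrightarrow> ?R")
proof
  assume ?L
  then obtain u where u: "u \<in> joined_tree L" "strict_prefix [] u" "Q u" by blast
  then obtain n v where "u = n # v"
    by (cases u) (auto simp: strict_prefix_def)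
  with u show ?R by auto
next
  assume ?R
  then obtain n u where "u \<in> L n" "Q (n # u)" by blast
  then show ?L
    by (intro bexI[of _ "n # u"]) auto
qed

lemma leaves_joined_tree: "n # t \<in> leaves (joined_tree L) \<longleftrightarrow> t \<in> leaves (L n)"
proof -
  have "(\<exists>u\<in>joined_tree L. strict_prefix (n # t) u) \<longleftrightarrow> (\<exists>u\<in>L n. strict_prefix t u)"
    using extension_in_joined_tree[of L n t "\<lambda>_. True"] by simp
  then show ?thesis
    unfolding leaves_def mem_Collect_eq Cons_in_joined_tree by simp
qed

lemma no_infinite_branch_joined_tree:
  assumes "\<And>n. no_infinite_branch (L n)"
  shows "no_infinite_branch (joined_tree L)"
  unfolding no_infinite_branch_def
proof
  assume "\<exists>b. \<forall>k. b k \<in> joined_tree L \<and> strict_prefix (b k) (b (Suc k))"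
  then obtain b where b: "\<And>k. b k \<in> joined_tree L" "\<And>k. strict_prefix (b k) (b (Suc k))"
    by blast
  obtain n t where nt: "b 1 = n # t"
    using b(2)[of 0] by (cases "b 1") auto
  have head: "\<exists>t. b (Suc k) = n # t" for k
  proof (induction k)
    case (Suc k)
    then show ?case
      using b(2)[of "Suc k"] by (auto simp: strict_prefix_def prefix_def)
  qed (simp add: nt[unfolded One_nat_def])
  then obtain c where c: "\<And>k. b (Suc k) = n # c k"
    by metis
  have "c k \<in> L n" "strict_prefix (c k) (c (Suc k))" for k
    using b(1)[of "Suc k"] b(2)[of "Suc k"] by (simp_all add: c)
  with assms show False
    unfolding no_infinite_branch_def by blast
qed

text \<open>The rank of a node depends only on the part of the tree above it.\<close>

lemma node_rank_joined_tree:
  assumes "\<And>n. no_infinite_branch (L n)" "t \<in> L n"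
  shows "node_rank (joined_tree L) (n # t) = node_rank (L n) t"
  using assms(1)[of n] assms(2)
proof (induction t rule: well_founded_tree_induct)
  case (1 t)
  have "z < node_rank (joined_tree L) (n # t) \<longleftrightarrow> z < node_rank (L n) t" for z
  proof -
    have "z < node_rank (joined_tree L) (n # t) \<longleftrightarrow>
        (\<exists>u\<in>joined_tree L. strict_prefix (n # t) u \<and> z \<le> node_rank (joined_tree L) u)"
      using 1(1) by (intro less_node_rank_iff no_infinite_branch_joined_tree assms(1)) simp
    also have "\<dots> \<longleftrightarrow> (\<exists>u\<in>L n. strict_prefix t u \<and> z \<le> node_rank (joined_tree L) (n # u))"
      by (rule extension_in_joined_tree)
    also have "\<dots> \<longleftrightarrow> (\<exists>u\<in>L n. strict_prefix t u \<and> z \<le> node_rank (L n) u)"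
      using 1(2) by auto
    also have "\<dots> \<longleftrightarrow> z < node_rank (L n) t"
      using 1(1) by (intro less_node_rank_iff[symmetric] assms(1))
    finally show ?thesis .
  qed
  then show ?case
    by (rule cord_eq_by_less)
qed

lemma tree_of_rank_joined_tree:
  assumes L: "\<And>n. tree_of_rank (Ord (g n + 1)) (L n)"
    and g: "(\<exists>\<gamma>. \<forall>n. g n = \<gamma>) \<or> strict_mono g" "\<And>z. z < \<alpha> \<longleftrightarrow> (\<exists>n. z \<le> g n)"
  shows "tree_of_rank (Ord (\<alpha> + 1)) (joined_tree L)"
proof -
  have root: "[] \<in> L n" and her: "hereditary (L n)" and wf: "no_infinite_branch (L n)" for n
    using L[of n] by auto
  note wfj = no_infinite_branch_joined_tree[of L, OF wf]
  note rank = node_rank_joined_tree[of L, OF wf]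
  have rank_root: "node_rank (L n) [] = g n" for n
    using L by (rule tree_of_rank_root)
  have "hereditary (joined_tree L)"
    unfolding hereditary_def
  proof (intro allI impI)
    fix s t assume st: "prefix s t \<and> t \<in> joined_tree L"
    show "s \<in> joined_tree L"
    proof (cases s)
      case (Cons n s')
      with st obtain t' where "t = n # t'" "prefix s' t'"
        by (cases t) auto
      with st her[of n] Cons show ?thesis
        by (auto simp: hereditary_def)
    qed simp
  qed
  moreover have "node_rank (joined_tree L) [] = \<alpha>"
  proof (rule cord_eq_by_less)
    fix z
    have le: "node_rank (L n) t \<le> g n" if t: "t \<in> L n" for n t
    proof (cases "t = []")
      case False
      then have "strict_prefix [] t"
        by (simp add: strict_prefix_def)
      then show ?thesis
        using less_node_rank_iff[OF wf root, of "node_rank (L n) t"] t rank_root less_imp_le by auto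
    qed (simp add: rank_root)
    have "z < node_rank (joined_tree L) [] \<longleftrightarrow>
        (\<exists>n. \<exists>t\<in>L n. z \<le> node_rank (joined_tree L) (n # t))"
      unfolding less_node_rank_iff[OF wfj Nil_in_joined_tree] by (rule root_extension_in_joined_tree)
    also have "\<dots> \<longleftrightarrow> (\<exists>n. \<exists>t\<in>L n. z \<le> node_rank (L n) t)"
      by (simp add: rank)
    also have "\<dots> \<longleftrightarrow> (\<exists>n. z \<le> g n)"
    proof
      assume "\<exists>n. \<exists>t\<in>L n. z \<le> node_rank (L n) t"
      then obtain n t where "t \<in> L n" "z \<le> node_rank (L n) t" by blast
      then have "z \<le> g n"
        using order_trans[OF _ le[of t n]] by blast
      then show "\<exists>n. z \<le> g n" ..
    next
      assume "\<exists>n. z \<le> g n"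
      then obtain n where "z \<le> g n" ..
      then have "z \<le> node_rank (L n) []"
        by (simp add: rank_root)
      then show "\<exists>n. \<exists>t\<in>L n. z \<le> node_rank (L n) t"
        using root by blast
    qed
    also have "\<dots> \<longleftrightarrow> z < \<alpha>"
      by (simp add: g(2))
    finally show "z < node_rank (joined_tree L) [] \<longleftrightarrow> z < \<alpha>" .
  qed
  moreover have "s \<in> leaves (joined_tree L) \<or> (\<forall>n. s @ [n] \<in> joined_tree L)"
    if "s \<in> joined_tree L" for s
  proof (cases s)
    case (Cons n s')
    with that L[of n] show ?thesis
      by (auto simp: leaves_joined_tree)
  qed (simp add: root)
  moreover have "(\<exists>\<gamma>. \<forall>n. node_rank (joined_tree L) (s @ [n]) = \<gamma>) \<or>
      strict_mono (\<lambda>n. node_rank (joined_tree L) (s @ [n]))"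
    if s: "s \<in> non_leaves (joined_tree L)" for s
  proof (cases s)
    case Nil
    then show ?thesis
      using g(1) by (simp add: rank root rank_root)
  next
    case (Cons k s')
    with s have s': "s' \<in> non_leaves (L k)"
      by (simp add: non_leaves_def leaves_joined_tree)
    then have "\<forall>n. s' @ [n] \<in> L k"
      using L[of k] by (auto simp: non_leaves_def)
    with L[of k] s' show ?thesis
      by (simp add: Cons rank)
  qed
  ultimately show ?thesis
    using wfj by simp
qed

lemma tree_of_rank_singleton: "tree_of_rank (Ord (0 + 1)) {[]}"
proof -
  have wf: "no_infinite_branch {[]}"
    unfolding no_infinite_branch_def by (metis prefix_order.less_irrefl singletonD)
  have "leaves {[]} = {[] :: nat list}"
    by (auto simp: leaves_def)
  then show ?thesis
    using wf node_rank_unfold[OF wf, of "[]"] by (simp add: hereditary_def non_leaves_def)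
qed

lemma exists_tree_of_rank: "\<exists>\<Lambda>. tree_of_rank (Ord (\<alpha> + 1)) \<Lambda>"
proof (induction \<alpha> rule: less_induct)
  case (less \<alpha>)
  show ?case
  proof (cases "\<alpha> = 0")
    case True
    then show ?thesis
      using tree_of_rank_singleton by blast
  next
    case False
    then have "0 < \<alpha>"
      using cord_zero_le[of \<alpha>] by simp
    then obtain g :: "nat \<Rightarrow> cord"
      where g: "(\<exists>\<gamma>. \<forall>n. g n = \<gamma>) \<or> strict_mono g" "\<And>z. z < \<alpha> \<longleftrightarrow> (\<exists>n. z \<le> g n)"
      by (rule cofinal_sequence) blast
    have "\<exists>\<Lambda>. tree_of_rank (Ord (g n + 1)) \<Lambda>" for n
      using less.IH g(2) by blast
    then obtain L where "\<And>n. tree_of_rank (Ord (g n + 1)) (L n)"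
      by metis
    then show ?thesis
      using tree_of_rank_joined_tree g by blast
  qed
qed

section \<open>Function spaces on trees and on their models\<close>

lemma cont_space_add: "f \<in> cont_space K \<Longrightarrow> g \<in> cont_space K \<Longrightarrow> (\<lambda>x. f x + g x) \<in> cont_space K"
  by (simp add: cont_space_def continuous_on_add)

lemma cont_space_mult: "f \<in> cont_space K \<Longrightarrow> (\<lambda>x. c * f x) \<in> cont_space K"
  by (simp add: cont_space_def continuous_on_mult_left)

lemma cont_model_eqI:
  assumes "cont_model m \<Lambda> K \<phi>" "f \<in> cont_space K" "g \<in> cont_space K"
    and "\<And>x. x \<in> tree_copies m \<Lambda> \<Longrightarrow> f (\<phi> x) = g (\<phi> x)"
  shows "f = g"
proof
  fix y
  have "(\<lambda>x. f x + (-1) * g x) \<in> cont_space K"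
    using assms(2,3) by (intro cont_space_add cont_space_mult)
  moreover have "\<forall>x\<in>tree_copies m \<Lambda>. \<bar>f (\<phi> x) + (-1) * g (\<phi> x)\<bar> \<le> 0"
    using assms(4) by simp
  ultimately have "\<forall>y\<in>K. \<bar>f y + (-1) * g y\<bar> \<le> 0"
    using assms(1) unfolding cont_model_def by fast
  then show "f y = g y"
    using assms(2,3) by (cases "y \<in> K") (auto simp: cont_space_def)
qed

lemma copies_unif_cont_bounded:
  assumes "copies_unif_cont m \<Lambda> f"
  obtains B where "\<And>x. x \<in> tree_copies m \<Lambda> \<Longrightarrow> \<bar>f x\<bar> \<le> B"
proof -
  have "\<forall>i\<in>{1..m}. \<exists>B. \<forall>s\<in>\<Lambda>. \<bar>f (s, i)\<bar> \<le> B"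
    using assms code_unif_cont_bounded unfolding copies_unif_cont_def by meson
  then obtain B where B: "\<And>i s. i \<in> {1..m} \<Longrightarrow> s \<in> \<Lambda> \<Longrightarrow> \<bar>f (s, i)\<bar> \<le> B i"
    by metis
  have "\<bar>f x\<bar> \<le> (\<Sum>i\<in>{1..m}. \<bar>B i\<bar>)" if x: "x \<in> tree_copies m \<Lambda>" for x
  proof -
    obtain s i where si: "x = (s, i)" "s \<in> \<Lambda>" "i \<in> {1..m}"
      using x by (auto simp: tree_copies_def)
    then have "\<bar>f x\<bar> \<le> \<bar>B i\<bar>"
      using B[of i s] by simp
    also have "\<dots> \<le> (\<Sum>i\<in>{1..m}. \<bar>B i\<bar>)"
      using si(3) by (intro member_le_sum) auto
    finally show ?thesis .
  qed
  then show thesis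
    by (rule that)
qed

lemma sup_norm_le_iff_cont_model:
  assumes "cont_model m \<Lambda> K \<phi>" "[] \<in> \<Lambda>" "m \<ge> 1" "g \<in> cont_space K"
  shows "sup_norm K g \<le> B \<longleftrightarrow> (\<forall>x\<in>tree_copies m \<Lambda>. \<bar>g (\<phi> x)\<bar> \<le> B)"
proof -
  have dense: "(\<forall>x\<in>tree_copies m \<Lambda>. \<bar>g (\<phi> x)\<bar> \<le> C) \<longleftrightarrow> (\<forall>y\<in>K. \<bar>g y\<bar> \<le> C)" for C
    using assms(1,4) unfolding cont_model_def by blast
  have "copies_unif_cont m \<Lambda> (\<lambda>x. g (\<phi> x))"
    using assms(1,4) by (simp add: cont_model_def)
  then obtain C where "\<forall>x\<in>tree_copies m \<Lambda>. \<bar>g (\<phi> x)\<bar> \<le> C"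
    using copies_unif_cont_bounded by metis
  then have bdd: "bdd_above ((\<lambda>y. \<bar>g y\<bar>) ` K)"
    unfolding dense by (auto intro: bdd_aboveI2)
  have "K \<noteq> {}"
    using assms(1-3) by (auto simp: cont_model_def tree_copies_def)
  then show ?thesis
    unfolding dense sup_norm_def using bdd by (rule cSUP_le_iff)
qed

text \<open>The function \<open>\<Psi> a\<close> on \<open>K\<close> restricts to the path sums of \<open>a\<close>, and \<open>\<Theta>\<close> takes increments of the
restriction. Both norms have the same upper bounds, namely the bounds of these path sums.\<close>

lemma cont_model_isometry:
  assumes "hereditary \<Lambda>" "[] \<in> \<Lambda>" "m \<ge> 1" "cont_model m \<Lambda> K \<phi>"
  obtains \<Psi> \<Theta> where
    "\<And>a. a \<in> tree_space_power m \<Lambda> \<Longrightarrow> \<Psi> a \<in> cont_space K"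
    "\<And>g. g \<in> cont_space K \<Longrightarrow> \<Theta> g \<in> tree_space_power m \<Lambda>"
    "\<And>a. a \<in> tree_space_power m \<Lambda> \<Longrightarrow> \<Theta> (\<Psi> a) = a"
    "\<And>g. g \<in> cont_space K \<Longrightarrow> \<Psi> (\<Theta> g) = g"
    "\<And>a b. a \<in> tree_space_power m \<Lambda> \<Longrightarrow> b \<in> tree_space_power m \<Lambda> \<Longrightarrow>
      \<Psi> (\<lambda>x. a x + b x) = (\<lambda>y. \<Psi> a y + \<Psi> b y)"
    "\<And>a c. a \<in> tree_space_power m \<Lambda> \<Longrightarrow> \<Psi> (\<lambda>x. c * a x) = (\<lambda>y. c * \<Psi> a y)"
    "\<And>a. a \<in> tree_space_power m \<Lambda> \<Longrightarrow> sup_norm K (\<Psi> a) = tree_power_norm m \<Lambda> a"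
proof -
  note eqI = cont_model_eqI[OF assms(4)]
  have "\<exists>g\<in>cont_space K. \<forall>x\<in>tree_copies m \<Lambda>. g (\<phi> x) = tree_delta x a"
    if "a \<in> tree_space_power m \<Lambda>" for a
    using assms(4) that unfolding mem_tree_space_power_iff[OF assms(1,2)] cont_model_def by blast
  then obtain \<Psi> where \<Psi>: "\<And>a. a \<in> tree_space_power m \<Lambda> \<Longrightarrow> \<Psi> a \<in> cont_space K"
    "\<And>a x. a \<in> tree_space_power m \<Lambda> \<Longrightarrow> x \<in> tree_copies m \<Lambda> \<Longrightarrow> \<Psi> a (\<phi> x) = tree_delta x a"
    by metis
  define \<Theta> where "\<Theta> g = copies_increments m \<Lambda> (\<lambda>x. g (\<phi> x))" for g
  have \<Theta>: "\<Theta> g \<in> tree_space_power m \<Lambda>" if "g \<in> cont_space K" for g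
    using assms(4) that unfolding \<Theta>_def cont_model_def by (intro copies_increments_mem[OF assms(1,2)]) blast
  have \<Theta>_delta: "tree_delta x (\<Theta> g) = g (\<phi> x)" if "x \<in> tree_copies m \<Lambda>" for g x
    unfolding \<Theta>_def by (rule tree_delta_copies_increments[OF assms(1) that])
  show thesis
  proof (rule that[of \<Psi> \<Theta>])
    show "\<Theta> (\<Psi> a) = a" if "a \<in> tree_space_power m \<Lambda>" for a
      using that by (intro tree_space_power_eqI[OF assms(1)]) (auto simp: \<Theta> \<Psi> \<Theta>_delta)
    show "\<Psi> (\<Theta> g) = g" if "g \<in> cont_space K" for g
      using that by (intro eqI) (auto simp: \<Theta> \<Psi> \<Theta>_delta)
    show "\<Psi> (\<lambda>x. a x + b x) = (\<lambda>y. \<Psi> a y + \<Psi> b y)"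
      if "a \<in> tree_space_power m \<Lambda>" "b \<in> tree_space_power m \<Lambda>" for a b
      using that tree_space_power_add[OF assms(1,2)]
      by (intro eqI cont_space_add) (auto simp: \<Psi> tree_delta_add)
    show "\<Psi> (\<lambda>x. c * a x) = (\<lambda>y. c * \<Psi> a y)" if "a \<in> tree_space_power m \<Lambda>" for a c
      using that tree_space_power_mult[OF assms(1,2)]
      by (intro eqI cont_space_mult) (auto simp: \<Psi> tree_delta_mult)
    show "sup_norm K (\<Psi> a) = tree_power_norm m \<Lambda> a" if a: "a \<in> tree_space_power m \<Lambda>" for a
    proof -
      have "sup_norm K (\<Psi> a) \<le> B \<longleftrightarrow> tree_power_norm m \<Lambda> a \<le> B" for B
        using a sup_norm_le_iff_cont_model[OF assms(4,2,3) \<Psi>(1)[OF a]]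
          tree_power_norm_le_iff[OF assms(1-3) a] by (simp add: \<Psi>(2))
      then show ?thesis
        by (meson antisym order_refl)
    qed
  qed (use \<Psi> \<Theta> in auto)
qed

lemma cont_space_isometric_to_iff_tree_space:
  fixes F :: "'e::real_normed_vector set"
  assumes "hereditary \<Lambda>" "[] \<in> \<Lambda>" "m \<ge> 1" "cont_model m \<Lambda> K \<phi>"
  shows "cont_space_isometric_to K F \<longleftrightarrow>
    (\<exists>T. isometric_embedding (tree_space_power m \<Lambda>) (tree_power_norm m \<Lambda>) T \<and>
      T ` tree_space_power m \<Lambda> = F)"
proof -
  obtain \<Psi> \<Theta> where P:
    "\<And>a. a \<in> tree_space_power m \<Lambda> \<Longrightarrow> \<Psi> a \<in> cont_space K"
    "\<And>g. g \<in> cont_space K \<Longrightarrow> \<Theta> g \<in> tree_space_power m \<Lambda>"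
    "\<And>a. a \<in> tree_space_power m \<Lambda> \<Longrightarrow> \<Theta> (\<Psi> a) = a"
    "\<And>g. g \<in> cont_space K \<Longrightarrow> \<Psi> (\<Theta> g) = g"
    "\<And>a b. a \<in> tree_space_power m \<Lambda> \<Longrightarrow> b \<in> tree_space_power m \<Lambda> \<Longrightarrow>
      \<Psi> (\<lambda>x. a x + b x) = (\<lambda>y. \<Psi> a y + \<Psi> b y)"
    "\<And>a c. a \<in> tree_space_power m \<Lambda> \<Longrightarrow> \<Psi> (\<lambda>x. c * a x) = (\<lambda>y. c * \<Psi> a y)"
    "\<And>a. a \<in> tree_space_power m \<Lambda> \<Longrightarrow> sup_norm K (\<Psi> a) = tree_power_norm m \<Lambda> a"
    by (rule cont_model_isometry[OF assms]) blast
  note add = tree_space_power_add[OF assms(1,2)]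
  note mult = tree_space_power_mult[OF assms(1,2)]
  have \<Theta>_add: "\<Theta> (\<lambda>y. f y + g y) = (\<lambda>x. \<Theta> f x + \<Theta> g x)" if "f \<in> cont_space K" "g \<in> cont_space K" for f g
    using P(3)[OF add[OF P(2)[OF that(1)] P(2)[OF that(2)]]] that by (simp add: P)
  have \<Theta>_mult: "\<Theta> (\<lambda>y. c * f y) = (\<lambda>x. c * \<Theta> f x)" if "f \<in> cont_space K" for f c
    using P(3)[OF mult[OF P(2)[OF that], of c]] that by (simp add: P)
  have \<Psi>_image: "\<Psi> ` tree_space_power m \<Lambda> = cont_space K"
    using P(1,2,4) by force
  have \<Theta>_image: "\<Theta> ` cont_space K = tree_space_power m \<Lambda>"
    using P(1-3) by force
  show ?thesis
  proof
    assume "cont_space_isometric_to K F"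
    then obtain J where J: "isometric_embedding (cont_space K) (sup_norm K) J" "J ` cont_space K = F"
      by (auto simp: cont_space_isometric_to_def)
    have "isometric_embedding (tree_space_power m \<Lambda>) (tree_power_norm m \<Lambda>) (\<lambda>a. J (\<Psi> a))"
      using J(1) by (simp add: isometric_embedding_def linear_map_on_def P)
    moreover have "(\<lambda>a. J (\<Psi> a)) ` tree_space_power m \<Lambda> = F"
      using J(2) \<Psi>_image by (simp flip: image_image)
    ultimately show "\<exists>T. isometric_embedding (tree_space_power m \<Lambda>) (tree_power_norm m \<Lambda>) T \<and>
        T ` tree_space_power m \<Lambda> = F"
      by blast
  next
    assume "\<exists>T. isometric_embedding (tree_space_power m \<Lambda>) (tree_power_norm m \<Lambda>) T \<and>
      T ` tree_space_power m \<Lambda> = F"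
    then obtain T where T: "isometric_embedding (tree_space_power m \<Lambda>) (tree_power_norm m \<Lambda>) T"
      "T ` tree_space_power m \<Lambda> = F"
      by blast
    have "norm (T (\<Theta> g)) = sup_norm K g" if "g \<in> cont_space K" for g
      using T(1) P(2)[OF that] P(7)[OF P(2)[OF that]] P(4)[OF that] by (simp add: isometric_embedding_def)
    then have "isometric_embedding (cont_space K) (sup_norm K) (\<lambda>g. T (\<Theta> g))"
      using T(1) by (simp add: isometric_embedding_def linear_map_on_def P \<Theta>_add \<Theta>_mult)
    moreover have "(\<lambda>g. T (\<Theta> g)) ` cont_space K = F"
      using T(2) \<Theta>_image by (simp flip: image_image)
    ultimately show "cont_space_isometric_to K F"
      unfolding cont_space_isometric_to_def by blast
  qed
qed

section \<open>Projections and projectional trees\<close>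

lemma isometric_embedding_add:
  "isometric_embedding V N T \<Longrightarrow> a \<in> V \<Longrightarrow> b \<in> V \<Longrightarrow> T (\<lambda>x. a x + b x) = T a + T b"
  by (simp add: isometric_embedding_def linear_map_on_def)

lemma isometric_embedding_mult:
  "isometric_embedding V N T \<Longrightarrow> a \<in> V \<Longrightarrow> T (\<lambda>x. c * a x) = c *\<^sub>R T a"
  by (simp add: isometric_embedding_def linear_map_on_def)

lemma isometric_embedding_norm: "isometric_embedding V N T \<Longrightarrow> a \<in> V \<Longrightarrow> norm (T a) = N a"
  by (simp add: isometric_embedding_def)

lemma isometric_embedding_inj:
  fixes T :: "(nat list \<times> nat \<Rightarrow> real) \<Rightarrow> 'e::real_normed_vector"
  assumes "hereditary \<Lambda>" "[] \<in> \<Lambda>" "m \<ge> 1"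
    and T: "isometric_embedding (tree_space_power m \<Lambda>) (tree_power_norm m \<Lambda>) T"
    and ab: "a \<in> tree_space_power m \<Lambda>" "b \<in> tree_space_power m \<Lambda>" "T a = T b"
  shows "a = b"
proof (rule tree_space_power_eqI[OF assms(1) ab(1,2)])
  fix x assume x: "x \<in> tree_copies m \<Lambda>"
  have mb: "(\<lambda>x. (-1) * b x) \<in> tree_space_power m \<Lambda>"
    by (rule tree_space_power_mult[OF assms(1,2) ab(2)])
  then have d: "(\<lambda>x. a x + (-1) * b x) \<in> tree_space_power m \<Lambda>"
    by (rule tree_space_power_add[OF assms(1,2) ab(1)])
  have "T (\<lambda>x. a x + (-1) * b x) = T a + T (\<lambda>x. (-1) * b x)"
    by (rule isometric_embedding_add[OF T ab(1) mb])
  also have "T (\<lambda>x. (-1) * b x) = (-1) *\<^sub>R T b"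
    by (rule isometric_embedding_mult[OF T ab(2)])
  finally have "T (\<lambda>x. a x + (-1) * b x) = 0"
    using ab(3) by simp
  then have "tree_power_norm m \<Lambda> (\<lambda>x. a x + (-1) * b x) \<le> 0"
    using isometric_embedding_norm[OF T d] by simp
  then have "\<bar>tree_delta x (\<lambda>x. a x + (-1) * b x)\<bar> \<le> 0"
    using tree_power_norm_le_iff[OF assms(1-3) d] x by blast
  then show "tree_delta x a = tree_delta x b"
    unfolding tree_delta_add tree_delta_mult by simp
qed

text \<open>Since \<open>T\<close> is injective, \<open>P e = T (R e)\<close> defines a linear map \<open>R\<close> into the space on the tree with
\<open>R (T a) = a\<close>; the functionals \<open>\<rho> x\<close> are the compositions of \<open>R\<close> with the path sums, bounded by the
norm of \<open>P\<close> because \<open>T\<close> is isometric.\<close>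

lemma projectional_tree_of_projection:
  fixes T :: "(nat list \<times> nat \<Rightarrow> real) \<Rightarrow> 'e::real_normed_vector"
  assumes "hereditary \<Lambda>" "[] \<in> \<Lambda>" "m \<ge> 1" "tree_of_rank \<beta> \<Lambda>"
    and T: "isometric_embedding (tree_space_power m \<Lambda>) (tree_power_norm m \<Lambda>) T"
    and compl: "complemented (T ` tree_space_power m \<Lambda>)"
  shows "\<exists>\<rho>. isometric_projectional_tree \<beta> m \<Lambda> T \<rho>"
proof -
  let ?A = "tree_space_power m \<Lambda>"
  obtain P where P: "bounded_linear P" "\<And>x. P (P x) = P x" "range P = T ` ?A"
    using compl by (auto simp: complemented_def)
  interpret P: bounded_linear P by (rule P(1))
  obtain C where C: "\<And>e. norm (P e) \<le> norm e * C"
    using P.bounded by blast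
  note T_add = isometric_embedding_add[OF T] and T_mult = isometric_embedding_mult[OF T]
    and T_norm = isometric_embedding_norm[OF T]
  note inj = isometric_embedding_inj[OF assms(1-3) T]
  note add = tree_space_power_add[OF assms(1,2)]
  note mult = tree_space_power_mult[OF assms(1,2)]
  have "\<exists>a\<in>?A. T a = P e" for e
    using P(3) by (metis imageE rangeI)
  then obtain R where R: "\<And>e. R e \<in> ?A" "\<And>e. T (R e) = P e"
    by metis
  have R_add: "R (e + e') = (\<lambda>x. R e x + R e' x)" for e e'
    by (intro inj add R(1)) (simp add: T_add R P.add)
  have R_scale: "R (c *\<^sub>R e) = (\<lambda>x. c * R e x)" for c e
    by (intro inj mult R(1)) (simp add: T_mult R P.scaleR)
  have R_T: "R (T a) = a" if a: "a \<in> ?A" for a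
  proof (rule inj[OF R(1) a])
    obtain e where "T a = P e"
      using P(3) a by (metis imageE imageI)
    then show "T (R (T a)) = T a"
      by (simp add: R(2) P(2))
  qed
  define \<rho> where "\<rho> x = Blinfun (\<lambda>e. tree_delta x (R e))" for x
  have bound: "\<bar>tree_delta x (R e)\<bar> \<le> norm e * C" if x: "x \<in> tree_copies m \<Lambda>" for x e
  proof -
    have "tree_power_norm m \<Lambda> (R e) \<le> norm e * C"
      using C[of e] T_norm[OF R(1), of e] by (simp add: R(2))
    then show ?thesis
      using tree_power_norm_le_iff[OF assms(1-3) R(1)] x by blast
  qed
  have \<rho>: "blinfun_apply (\<rho> x) e = tree_delta x (R e)" if x: "x \<in> tree_copies m \<Lambda>" for x e
  proof -
    have "bounded_linear (\<lambda>e. tree_delta x (R e))"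
      using bound[OF x] by (intro bounded_linear_intro[where K = C])
        (auto simp: R_add R_scale tree_delta_add tree_delta_mult)
    then show ?thesis
      by (simp add: \<rho>_def bounded_linear_Blinfun_apply)
  qed
  have "bounded (\<rho> ` tree_copies m \<Lambda>)"
    unfolding bounded_iff
  proof (intro exI ballI)
    fix r assume "r \<in> \<rho> ` tree_copies m \<Lambda>"
    then obtain x where x: "x \<in> tree_copies m \<Lambda>" "r = \<rho> x" by blast
    show "norm r \<le> \<bar>C\<bar>"
    proof (rule norm_blinfun_bound)
      fix e :: 'e
      have "norm e * C \<le> norm e * \<bar>C\<bar>"
        by (intro mult_left_mono) auto
      then show "norm (blinfun_apply r e) \<le> \<bar>C\<bar> * norm e"
        using bound[OF x(1), of e] by (simp add: x(2) \<rho>[OF x(1)] mult.commute)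
    qed simp
  qed
  moreover have "unif_weak_star_continuous_on (tree_copies m \<Lambda>) copies_dist \<rho>"
    unfolding unif_weak_star_continuous_on_copies_iff
  proof
    fix e
    have "copies_unif_cont m \<Lambda> (\<lambda>x. tree_delta x (R e))"
      using R(1) by (simp add: mem_tree_space_power_iff[OF assms(1,2)])
    then show "copies_unif_cont m \<Lambda> (\<lambda>x. blinfun_apply (\<rho> x) e)"
      by (subst copies_unif_cont_cong[OF \<rho>])
  qed
  moreover have "isomorphic_embedding ?A (tree_power_norm m \<Lambda>) T"
    using T unfolding isomorphic_embedding_def isometric_embedding_def
    by (auto intro!: exI[of _ "1::real"])
  moreover have "blinfun_apply (\<rho> x) (T a) = tree_delta x a" if "x \<in> tree_copies m \<Lambda>" "a \<in> ?A" for x a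
    using that by (simp add: \<rho> R_T)
  ultimately show ?thesis
    using assms(4) T unfolding isometric_projectional_tree_def projectional_tree_def by blast
qed

text \<open>The function \<open>x \<mapsto> \<rho> x e\<close> is uniformly continuous, so it consists of the path sums of a
family \<open>R e\<close>. The condition on \<open>T\<close> and \<open>\<rho>\<close> says \<open>R (T a) = a\<close>, hence \<open>T \<circ> R\<close> is a projection onto the
range of \<open>T\<close>.\<close>

lemma complemented_of_projectional_tree:
  fixes T :: "(nat list \<times> nat \<Rightarrow> real) \<Rightarrow> 'e::real_normed_vector"
  assumes "hereditary \<Lambda>" "[] \<in> \<Lambda>" "m \<ge> 1" "isometric_projectional_tree \<beta> m \<Lambda> T \<rho>"
  shows "complemented (T ` tree_space_power m \<Lambda>)"
proof -
  let ?A = "tree_space_power m \<Lambda>"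
  have T: "isometric_embedding ?A (tree_power_norm m \<Lambda>) T"
    and cont: "\<And>e. copies_unif_cont m \<Lambda> (\<lambda>x. blinfun_apply (\<rho> x) e)"
    and bounded: "bounded (\<rho> ` tree_copies m \<Lambda>)"
    and \<rho>: "\<And>x a. x \<in> tree_copies m \<Lambda> \<Longrightarrow> a \<in> ?A \<Longrightarrow> blinfun_apply (\<rho> x) (T a) = tree_delta x a"
    using assms(4)
    by (auto simp: isometric_projectional_tree_def projectional_tree_def unif_weak_star_continuous_on_copies_iff)
  note T_add = isometric_embedding_add[OF T] and T_mult = isometric_embedding_mult[OF T]
    and T_norm = isometric_embedding_norm[OF T]
  obtain C where C: "\<And>x. x \<in> tree_copies m \<Lambda> \<Longrightarrow> norm (\<rho> x) \<le> C"
    using bounded by (auto simp: bounded_iff)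
  define R where "R e = copies_increments m \<Lambda> (\<lambda>x. blinfun_apply (\<rho> x) e)" for e
  have R: "R e \<in> ?A" for e
    unfolding R_def by (rule copies_increments_mem[OF assms(1,2) cont])
  have R_delta: "tree_delta x (R e) = blinfun_apply (\<rho> x) e" if "x \<in> tree_copies m \<Lambda>" for x e
    unfolding R_def by (rule tree_delta_copies_increments[OF assms(1) that])
  note eqI = tree_space_power_eqI[OF assms(1)]
  have R_add: "R (e + e') = (\<lambda>x. R e x + R e' x)" for e e'
    by (intro eqI[of _ m] R tree_space_power_add[OF assms(1,2)]) (simp add: tree_delta_add R_delta blinfun.add_right)
  have R_scale: "R (c *\<^sub>R e) = (\<lambda>x. c * R e x)" for c e
    by (intro eqI[of _ m] R tree_space_power_mult[OF assms(1,2)]) (simp add: tree_delta_mult R_delta blinfun.scaleR_right)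
  have R_T: "R (T a) = a" if "a \<in> ?A" for a
    using that by (intro eqI[of _ m] R) (simp_all add: R_delta \<rho>)
  have bl: "bounded_linear (\<lambda>e. T (R e))"
  proof (rule bounded_linear_intro[where K = C])
    fix e e' :: 'e and c :: real
    show "T (R (e + e')) = T (R e) + T (R e')"
      by (simp add: R_add T_add R)
    show "T (R (c *\<^sub>R e)) = c *\<^sub>R T (R e)"
      by (simp add: R_scale T_mult R)
    have "\<bar>tree_delta x (R e)\<bar> \<le> norm e * C" if x: "x \<in> tree_copies m \<Lambda>" for x
    proof -
      have "norm (blinfun_apply (\<rho> x) e) \<le> norm (\<rho> x) * norm e"
        by (rule norm_blinfun)
      also have "\<dots> \<le> C * norm e"
        by (intro mult_right_mono C x) simp
      finally show ?thesis
        by (simp add: R_delta[OF x] mult.commute)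
    qed
    then have "tree_power_norm m \<Lambda> (R e) \<le> norm e * C"
      using tree_power_norm_le_iff[OF assms(1-3) R] by blast
    then show "norm (T (R e)) \<le> norm e * C"
      by (simp add: T_norm R)
  qed
  have range: "range (\<lambda>e. T (R e)) = T ` ?A"
  proof
    show "range (\<lambda>e. T (R e)) \<subseteq> T ` ?A"
      using R by blast
    show "T ` ?A \<subseteq> range (\<lambda>e. T (R e))"
    proof
      fix y assume "y \<in> T ` ?A"
      then have "y = T (R y)"
        using R_T by auto
      then show "y \<in> range (\<lambda>e. T (R e))" by blast
    qed
  qed
  have idem: "T (R (T (R e))) = T (R e)" for e
    by (simp add: R_T R)
  have "range (\<lambda>e. T (R e)) = {e. T (R e) = e}"
    using idem by (auto intro: sym)
  moreover have "closed {e. T (R e) = e}"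
    by (intro closed_Collect_eq linear_continuous_on[OF bl] continuous_on_id)
  ultimately have "closed (T ` ?A)"
    using range by simp
  moreover have "subspace (T ` ?A)"
    unfolding range[symmetric]
    by (intro linear_subspace_image bounded_linear.linear[OF bl] subspace_UNIV)
  ultimately show ?thesis
    unfolding complemented_def using bl idem range by blast
qed

text \<open>One tree of the given rank suffices to construct a projectional tree from a projection. For the
converse, \<open>K\<close> has to be a model of every tree of that rank, since the projectional tree comes with a
tree of its own.\<close>

lemma complemented_iff_projectional_tree:
  assumes "\<And>\<Lambda>. tree_of_rank \<beta> \<Lambda> \<Longrightarrow>
      hereditary \<Lambda> \<and> [] \<in> \<Lambda> \<and> (\<exists>\<phi>. cont_model m \<Lambda> (K :: 'k::topological_space set) \<phi>)"
    and "\<exists>\<Lambda>. tree_of_rank \<beta> \<Lambda>" and m: "m \<ge> 1"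
  shows "(\<exists>F::'e::real_normed_vector set. complemented F \<and> cont_space_isometric_to K F) \<longleftrightarrow>
    (\<exists>\<Lambda> (T :: (nat list \<times> nat \<Rightarrow> real) \<Rightarrow> 'e) \<rho>. isometric_projectional_tree \<beta> m \<Lambda> T \<rho>)"
proof
  assume "\<exists>F::'e set. complemented F \<and> cont_space_isometric_to K F"
  then obtain F :: "'e set" where F: "complemented F" "cont_space_isometric_to K F"
    by blast
  obtain \<Lambda> \<phi> where \<Lambda>: "tree_of_rank \<beta> \<Lambda>" "hereditary \<Lambda>" "[] \<in> \<Lambda>" "cont_model m \<Lambda> K \<phi>"
    using assms by blast
  obtain T where "isometric_embedding (tree_space_power m \<Lambda>) (tree_power_norm m \<Lambda>) T"
    "T ` tree_space_power m \<Lambda> = F"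
    using F(2) cont_space_isometric_to_iff_tree_space[OF \<Lambda>(2,3) m \<Lambda>(4)] by blast
  then show "\<exists>\<Lambda> (T :: (nat list \<times> nat \<Rightarrow> real) \<Rightarrow> 'e) \<rho>. isometric_projectional_tree \<beta> m \<Lambda> T \<rho>"
    using projectional_tree_of_projection[OF \<Lambda>(2,3) m \<Lambda>(1)] F(1) by blast
next
  assume "\<exists>\<Lambda> (T :: (nat list \<times> nat \<Rightarrow> real) \<Rightarrow> 'e) \<rho>. isometric_projectional_tree \<beta> m \<Lambda> T \<rho>"
  then obtain \<Lambda> \<rho> and T :: "(nat list \<times> nat \<Rightarrow> real) \<Rightarrow> 'e"
    where T: "isometric_projectional_tree \<beta> m \<Lambda> T \<rho>"
    by blast
  then have "tree_of_rank \<beta> \<Lambda>"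
    by (simp add: isometric_projectional_tree_def projectional_tree_def)
  then obtain \<phi> where \<Lambda>: "hereditary \<Lambda>" "[] \<in> \<Lambda>" "cont_model m \<Lambda> K \<phi>"
    using assms(1) by blast
  have "cont_space_isometric_to K (T ` tree_space_power m \<Lambda>)"
    using T cont_space_isometric_to_iff_tree_space[OF \<Lambda>(1,2) m \<Lambda>(3)]
    by (auto simp: isometric_projectional_tree_def)
  then show "\<exists>F::'e set. complemented F \<and> cont_space_isometric_to K F"
    using complemented_of_projectional_tree[OF \<Lambda>(1,2) m T] by blast
qed

theorem theorem1p1:
  shows "(\<forall>(\<alpha>::cord) (m::nat). m \<ge> 1 \<longrightarrow>
      ((\<exists>F::'e::banach set. complemented F \<and>
          cont_space_isometric_to {1..omega_power \<alpha> * cord_of_nat m} F) \<longleftrightarrow>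
       (\<exists>\<Lambda> (T :: (nat list \<times> nat \<Rightarrow> real) \<Rightarrow> 'e) \<rho>.
          isometric_projectional_tree (Ord (\<alpha> + 1)) m \<Lambda> T \<rho>))) \<and>
    ((\<exists>F::'e set. complemented F \<and>
        cont_space_isometric_to (UNIV :: (nat \<Rightarrow> bool) set) F) \<longleftrightarrow>
     (\<exists>\<Lambda> (T :: (nat list \<times> nat \<Rightarrow> real) \<Rightarrow> 'e) \<rho>.
        isometric_projectional_tree Infinity 1 \<Lambda> T \<rho>))"
proof (intro conjI allI impI)
  fix \<alpha> :: cord and m :: nat assume "m \<ge> 1"
  then show "(\<exists>F::'e set. complemented F \<and>
      cont_space_isometric_to {1..omega_power \<alpha> * cord_of_nat m} F) \<longleftrightarrow>
    (\<exists>\<Lambda> (T :: (nat list \<times> nat \<Rightarrow> real) \<Rightarrow> 'e) \<rho>.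
      isometric_projectional_tree (Ord (\<alpha> + 1)) m \<Lambda> T \<rho>)"
    using cont_model_ordinal exists_tree_of_rank
    by (intro complemented_iff_projectional_tree) auto
next
  show "(\<exists>F::'e set. complemented F \<and>
      cont_space_isometric_to (UNIV :: (nat \<Rightarrow> bool) set) F) \<longleftrightarrow>
    (\<exists>\<Lambda> (T :: (nat list \<times> nat \<Rightarrow> real) \<Rightarrow> 'e) \<rho>. isometric_projectional_tree Infinity 1 \<Lambda> T \<rho>)"
    using cont_model_cantor
    by (intro complemented_iff_projectional_tree) (auto simp: hereditary_def)
qed

end
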